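(* Let $\mathbf{S}_n=\mathbf{X}_1+\dots+\mathbf{X}_n$ be a random walk in $\mathbb{R}^d$ with i.i.d. increments $\mathbf{X},\mathbf{X}_1,\mathbf{X}_2,\dots$ of the form $\mathbf{X}=R\boldsymbol{\Theta}$, where $\boldsymbol{\Theta}$ fulfils assumption (A2') (written out in the context) and the ellipsoid $\Omega=\Lambda(\mathbb{S}^{d-1})$ is defined by the linear transformation $\Lambda(\mathbf{x})=A\mathbf{x}$, where $A$ is a diagonal $d\times d$ matrix with $a_{k,k}>0$ for all $k=1,\dots,d$. Additionally, assume that $R$ has a Weibull distribution with parameter $\beta\in(0,1)$. Let $a>0$, let $c>\max_{1\le j\le d}1/a_{j,j}$, and let $I$ denote the $d\times d$ identity matrix. Then the quota share reinsurance defined by the matrix $Q=I-A^{-1}/c$ yields the inequality $$\lim_{n\to\infty}\frac{\log(\mathbb{P}(\|\mathbf{S}_n/n\|_2>a))}{h(n)}\ >\ \lim_{n\to\infty}\frac{\log(\mathbb{P}(\|(I-Q)\mathbf{S}_n/n\|_2>a))}{h(n)}.$$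
   Context: $\|\cdot\|_2$ is the Euclidean norm on $\mathbb{R}^d$ and $\mathbb{S}^{d-1}=\{\mathbf{x}\in\mathbb{R}^d:\|\mathbf{x}\|_2=1\}$. A quota share strategy is given by a diagonal matrix $Q$ with diagonal entries $0<q_{j,j}<1$; the reinsurance company covers the amount $(1-q_{j,j})X^j$ of component $j$. Weibull with parameter $\beta\in(0,1)$: $R\ge 0$ and $\mathbb{P}(R>x)=e^{-\kappa x^\beta}$, $x\ge0$, for some constant $\kappa>0$; the function $h$ is $h(x)=\kappa x^\beta$, so that $-\log\mathbb{P}(R>x)\sim h(x)$ as $x\to\infty$. (A2'): $\boldsymbol{\Theta}$ is a $d$-dimensional random vector taking values in the ellipsoid $\Omega$ centred at the origin, with $\mathbb{E}(R\boldsymbol{\Theta})=\mathbf{0}$. For every (measurable) set $S\subset\Omega$ with positive Lebesgue (surface) measure, $\mathbb{P}(\boldsymbol{\Theta}\in S)>0$ and $\lim_{x\to\infty}\mathbb{P}(\boldsymbol{\Theta}\in S\mid R>x)=\mathbb{P}(\boldsymbol{\Theta}\in S)$. *)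

theory Defs
  imports "HOL-Probability.Probability"
begin

text \<open>
  Hausdorff measure of integer dimension \<open>s\<close>, normalised so that it agrees with Lebesgue measure on
  \<open>s\<close>-dimensional subspaces. Empty covering sets contribute \<open>0\<close>, also for \<open>s = 0\<close>, so that the
  0-dimensional measure is the counting measure. Covers consist of bounded sets because
  \<open>diameter\<close> is unspecified on unbounded ones.
\<close>

definition hausdorff_premeasure :: "nat \<Rightarrow> real \<Rightarrow> 'a::metric_space set \<Rightarrow> ennreal" where
  "hausdorff_premeasure s \<delta> S =
     (INF U \<in> {U :: nat \<Rightarrow> 'a set. S \<subseteq> (\<Union>i. U i) \<and> (\<forall>i. bounded (U i) \<and> diameter (U i) \<le> \<delta>)}.
        \<Sum>i. if U i = {} then 0
             else ennreal (unit_ball_vol (real s) * (diameter (U i) / 2) ^ s))"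

definition hausdorff_measure :: "nat \<Rightarrow> 'a::metric_space set \<Rightarrow> ennreal" where
  "hausdorff_measure s S = (SUP \<delta> \<in> {0<..}. hausdorff_premeasure s \<delta> S)"

text \<open>The surface measure on hypersurfaces of \<open>\<real>\<^sup>d\<close> is the \<open>(d - 1)\<close>-dimensional Hausdorff measure.\<close>

definition surface_measure :: "(real ^ 'd) set \<Rightarrow> ennreal" where
  "surface_measure S = hausdorff_measure (CARD('d) - 1) S"

definition diagonal_matrix :: "real ^ 'd ^ 'd \<Rightarrow> bool" where
  "diagonal_matrix A \<longleftrightarrow> (\<forall>i j. i \<noteq> j \<longrightarrow> A $ i $ j = 0)"

definition quota_share :: "real ^ 'd ^ 'd \<Rightarrow> bool" where
  "quota_share Q \<longleftrightarrow> diagonal_matrix Q \<and> (\<forall>j. 0 < Q $ j $ j \<and> Q $ j $ j < 1)"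

definition ellipsoid :: "real ^ 'd ^ 'd \<Rightarrow> (real ^ 'd) set" where
  "ellipsoid A = (\<lambda>x. A *v x) ` sphere 0 1"

definition weibull_h :: "real \<Rightarrow> real \<Rightarrow> real \<Rightarrow> real" where
  "weibull_h \<kappa> \<beta> x = \<kappa> * x powr \<beta>"

definition weibull :: "'a measure \<Rightarrow> real \<Rightarrow> real \<Rightarrow> ('a \<Rightarrow> real) \<Rightarrow> bool" where
  "weibull M \<kappa> \<beta> R \<longleftrightarrow>
     R \<in> borel_measurable M \<and> (AE \<omega> in M. R \<omega> \<ge> 0) \<and>
     (\<forall>x\<ge>0. \<P>(\<omega> in M. R \<omega> > x) = exp (- weibull_h \<kappa> \<beta> x))"

definition assumption_A2' ::
  "'a measure \<Rightarrow> (real ^ 'd) set \<Rightarrow> ('a \<Rightarrow> real) \<Rightarrow> ('a \<Rightarrow> real ^ 'd) \<Rightarrow> bool" where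
  "assumption_A2' M \<Omega> R \<Theta> \<longleftrightarrow>
     \<Theta> \<in> borel_measurable M \<and> (AE \<omega> in M. \<Theta> \<omega> \<in> \<Omega>) \<and>
     integrable M (\<lambda>\<omega>. R \<omega> *\<^sub>R \<Theta> \<omega>) \<and> (\<integral>\<omega>. R \<omega> *\<^sub>R \<Theta> \<omega> \<partial>M) = 0 \<and>
     (\<forall>S \<in> sets borel. S \<subseteq> \<Omega> \<and> surface_measure S > 0 \<longrightarrow>
        \<P>(\<omega> in M. \<Theta> \<omega> \<in> S) > 0 \<and>
        ((\<lambda>x. \<P>(\<omega> in M. \<Theta> \<omega> \<in> S \<bar> R \<omega> > x)) \<longlongrightarrow> \<P>(\<omega> in M. \<Theta> \<omega> \<in> S)) at_top)"

end

theory Submission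
  imports Defs "HOL-Real_Asymp.Real_Asymp"
begin

text \<open>
  One big jump: for centred i.i.d. vectors whose norm has the stretched exponential tail
  \<open>exp (- \<gamma> x\<^sup>\<beta>)\<close>, \<open>\<beta> < 1\<close>, the event \<open>norm S\<^sub>n > n a\<close> has logarithmic
  rate \<open>- \<gamma> (n a)\<^sup>\<beta>\<close>. The lower bound lets a single increment exceed \<open>n (a + \<delta>)\<close> while the
  others stay small; the upper bound is a Chernoff bound for increments truncated at the target
  level, applied to finitely many directions. Without reinsurance the heaviest direction is the
  longest semi-axis \<open>\<alpha> = max a\<^sub>j\<^sub>j\<close>, which gives \<open>\<gamma> = \<kappa> / \<alpha>\<^sup>\<beta>\<close>: (A2') keeps \<open>\<Theta>\<close> near its tip with
  positive conditional probability, because caps of the ellipsoid have positive surface measure.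
  As \<open>I - Q = A\<^sup>-\<^sup>1 / c\<close> maps the ellipsoid to the sphere of radius \<open>1 / c\<close>, the reinsured
  increments have norm exactly \<open>R / c\<close>, and \<open>\<gamma> = \<kappa> c\<^sup>\<beta>\<close> is larger since \<open>1 / c < \<alpha>\<close>.
\<close>

section \<open>Chernoff bound for variables truncated at the target level\<close>

text \<open>For nonnegative \<open>x\<close> this is Taylor's formula with remainder. For
  \<open>x = - y\<close>, the product of \<open>1 - y + y\<^sup>2\<close> with the quadratic
  minorant of \<open>exp y\<close> has no linear term and otherwise nonnegative coefficients, hence
  is at least 1. The factor \<open>exp (max x 0)\<close> is 1 for negative \<open>x\<close>, so
  truncation from above is enough to control it.\<close>

lemma exp_le_quadratic:
  fixes x :: real
  shows "exp x \<le> 1 + x + x\<^sup>2 * exp (max x 0)"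
proof (cases "x \<ge> 0")
  case True
  obtain s where s: "\<bar>s\<bar> \<le> \<bar>x\<bar>" "exp x = (\<Sum>m<2. x ^ m / fact m) + exp s / fact 2 * x ^ 2"
    using Maclaurin_exp_le by blast
  have "exp s / 2 * x\<^sup>2 \<le> exp x * x\<^sup>2"
  proof (rule mult_right_mono)
    have "exp s \<le> exp x" using s(1) True by simp
    then show "exp s / 2 \<le> exp x" using exp_gt_zero[of x] by linarith
  qed simp
  with s(2) True show ?thesis
    by (simp add: numeral_2_eq_2 mult.commute)
next
  case False
  define y where "y = - x"
  have y: "y > 0" using False by (simp add: y_def)
  have "1 \<le> 1 + y\<^sup>2 / 2 + y ^ 3 / 2 + y ^ 4 / 2"
    using y by simp
  also have "\<dots> = (1 - y + y\<^sup>2) * (1 + y + y\<^sup>2 / 2)"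
    by (simp add: field_simps power2_eq_square power3_eq_cube power4_eq_xxxx)
  also have "\<dots> \<le> (1 - y + y\<^sup>2) * exp y"
  proof (intro mult_left_mono exp_lower_Taylor_quadratic)
    have "1 - y + y\<^sup>2 = (1 - y / 2)\<^sup>2 + 3 / 4 * y\<^sup>2"
      by (simp add: power2_eq_square field_simps)
    then show "0 \<le> 1 - y + y\<^sup>2" by simp
  qed (use y in simp)
  finally have "exp (- y) \<le> 1 - y + y\<^sup>2"
    by (simp add: exp_minus field_simps)
  with False show ?thesis by (simp add: y_def)
qed

context prob_space
begin

text \<open>Zero mean removes the linear term of the quadratic bound, and the weighted second moment
  controls the rest, so the cost is only quadratic in \<open>\<theta>\<close>. The value of
  \<open>\<theta>\<close> makes the line \<open>\<theta> * z\<close> meet the curve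
  \<open>\<mu> * z powr \<beta>\<close> exactly at \<open>z = t\<close>.\<close>

lemma truncated_exponential_moment:
  fixes Z :: "'a \<Rightarrow> real"
  assumes "integrable M Z" "expectation Z = 0"
    and "integrable M (\<lambda>\<omega>. (Z \<omega>)\<^sup>2 * exp (\<mu> * \<bar>Z \<omega>\<bar> powr \<beta>))"
    and "expectation (\<lambda>\<omega>. (Z \<omega>)\<^sup>2 * exp (\<mu> * \<bar>Z \<omega>\<bar> powr \<beta>)) \<le> K"
    and "\<beta> < 1" "0 < \<mu>" "0 < t"
  defines "\<theta> \<equiv> \<mu> * t powr (\<beta> - 1)"
  shows "expectation (\<lambda>\<omega>. if Z \<omega> \<le> t then exp (\<theta> * Z \<omega>) else 0) \<le> exp (\<theta>\<^sup>2 * K)" (is "?E \<le> _")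
    and "integrable M (\<lambda>\<omega>. if Z \<omega> \<le> t then exp (\<theta> * Z \<omega>) else 0)"
proof -
  have [measurable]: "Z \<in> borel_measurable M" using assms(1) by auto
  have \<theta>: "\<theta> > 0" using assms by (simp add: \<theta>_def)
  show int: "integrable M (\<lambda>\<omega>. if Z \<omega> \<le> t then exp (\<theta> * Z \<omega>) else 0)"
  proof (rule integrable_const_bound[where B = "exp (\<theta> * t)"])
    show "AE \<omega> in M. norm (if Z \<omega> \<le> t then exp (\<theta> * Z \<omega>) else 0) \<le> exp (\<theta> * t)"
      using \<theta> by auto
  qed measurable
  have pw: "(if z \<le> t then exp (\<theta> * z) else 0)
      \<le> 1 + \<theta> * z + \<theta>\<^sup>2 * (z\<^sup>2 * exp (\<mu> * \<bar>z\<bar> powr \<beta>))" for z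
  proof (cases "z \<le> t")
    case True
    \<comment> \<open>Truncation and \<open>\<beta> < 1\<close> make the linear exponent no larger than the stretched one.\<close>
    have "max (\<theta> * z) 0 \<le> \<mu> * \<bar>z\<bar> powr \<beta>"
    proof (cases "z > 0")
      case z: True
      have "t powr (\<beta> - 1) * z \<le> z powr (\<beta> - 1) * z"
        using z True assms(5) by (intro mult_right_mono powr_mono2') auto
      also have "\<dots> = z powr \<beta>"
        using z by (simp add: powr_diff)
      finally show ?thesis
        using z assms(6) by (simp add: \<theta>_def)
    next
      case False
      then show ?thesis using \<theta> assms(6) by (auto simp: max_def mult_nonneg_nonpos not_less)
    qed
    then have "(\<theta> * z)\<^sup>2 * exp (max (\<theta> * z) 0) \<le> (\<theta> * z)\<^sup>2 * exp (\<mu> * \<bar>z\<bar> powr \<beta>)"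
      by (intro mult_left_mono) auto
    with exp_le_quadratic[of "\<theta> * z"] True show ?thesis
      by (simp add: power_mult_distrib mult.assoc)
  next
    case False
    then show ?thesis using \<theta> assms(7) by simp
  qed
  have "?E \<le> expectation (\<lambda>\<omega>. 1 + \<theta> * Z \<omega> + \<theta>\<^sup>2 * ((Z \<omega>)\<^sup>2 * exp (\<mu> * \<bar>Z \<omega>\<bar> powr \<beta>)))"
    using assms(1,3) by (intro integral_mono int pw) auto
  also have "\<dots> = 1 + \<theta>\<^sup>2 * expectation (\<lambda>\<omega>. (Z \<omega>)\<^sup>2 * exp (\<mu> * \<bar>Z \<omega>\<bar> powr \<beta>))"
    using assms(1,2,3) by (simp add: prob_space)
  also have "\<dots> \<le> 1 + \<theta>\<^sup>2 * K"
    using assms(4) by (simp add: mult_left_mono)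
  also have "\<dots> \<le> exp (\<theta>\<^sup>2 * K)"
    by (rule exp_ge_add_one_self)
  finally show "?E \<le> exp (\<theta>\<^sup>2 * K)" .
qed

lemma stretched_exponential_tail:
  fixes Z :: "'a \<Rightarrow> real"
  assumes [measurable]: "Z \<in> borel_measurable M"
    and int: "integrable M (\<lambda>\<omega>. (Z \<omega>)\<^sup>2 * exp (\<mu> * \<bar>Z \<omega>\<bar> powr \<beta>))"
    and K: "expectation (\<lambda>\<omega>. (Z \<omega>)\<^sup>2 * exp (\<mu> * \<bar>Z \<omega>\<bar> powr \<beta>)) \<le> K"
    and "0 < \<beta>" "0 < \<mu>" "1 \<le> t"
  shows "prob {\<omega> \<in> space M. Z \<omega> > t} \<le> K * exp (- \<mu> * t powr \<beta>)"
proof -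
  let ?f = "\<lambda>\<omega>. (Z \<omega>)\<^sup>2 * exp (\<mu> * \<bar>Z \<omega>\<bar> powr \<beta>)"
  have "exp (\<mu> * t powr \<beta>) \<le> z\<^sup>2 * exp (\<mu> * \<bar>z\<bar> powr \<beta>)" if "z > t" for z
  proof -
    have "t powr \<beta> \<le> \<bar>z\<bar> powr \<beta>" using that assms by (intro powr_mono2) auto
    then have "exp (\<mu> * t powr \<beta>) \<le> exp (\<mu> * \<bar>z\<bar> powr \<beta>)" using assms by simp
    moreover have "1 \<le> z\<^sup>2" using that assms by (intro one_le_power) auto
    ultimately show ?thesis
      using mult_mono[of 1 "z\<^sup>2" "exp (\<mu> * t powr \<beta>)" "exp (\<mu> * \<bar>z\<bar> powr \<beta>)"] by simp
  qed
  then have "prob {\<omega> \<in> space M. Z \<omega> > t} \<le> prob {\<omega> \<in> space M. exp (\<mu> * t powr \<beta>) \<le> ?f \<omega>}"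
    by (intro finite_measure_mono) auto
  also have "\<dots> \<le> expectation ?f / exp (\<mu> * t powr \<beta>)"
    by (intro integral_Markov_inequality_measure[where A = "space M", unfolded Int_absorb2] int) auto
  also have "\<dots> \<le> K / exp (\<mu> * t powr \<beta>)"
    using K by (intro divide_right_mono) auto
  finally show ?thesis by (simp add: exp_minus field_simps)
qed

text \<open>Either some summand exceeds \<open>t\<close>, which a union bound over single tails
  controls, or the exponential Markov inequality applies to the truncated moments. Truncating at the
  target level itself gives both events the same leading cost
  \<open>exp (- \<mu> * t powr \<beta>)\<close>. For \<open>t\<close> and \<open>card I\<close> of
  order \<open>n\<close> the correction in the exponent is of order
  \<open>n powr (2 * \<beta> - 1)\<close>, negligible against \<open>n powr \<beta>\<close>.\<close>

lemma truncated_chernoff: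
  fixes Z :: "'i \<Rightarrow> 'a \<Rightarrow> real" and K \<mu> :: real
  assumes I: "finite I" and indep: "indep_vars (\<lambda>_. borel) Z I"
    and mean: "\<And>i. i \<in> I \<Longrightarrow> integrable M (Z i)" "\<And>i. i \<in> I \<Longrightarrow> expectation (Z i) = 0"
    and int: "\<And>i. i \<in> I \<Longrightarrow> integrable M (\<lambda>\<omega>. (Z i \<omega>)\<^sup>2 * exp (\<mu> * \<bar>Z i \<omega>\<bar> powr \<beta>))"
    and K: "\<And>i. i \<in> I \<Longrightarrow> expectation (\<lambda>\<omega>. (Z i \<omega>)\<^sup>2 * exp (\<mu> * \<bar>Z i \<omega>\<bar> powr \<beta>)) \<le> K" "0 \<le> K"
    and \<beta>: "0 < \<beta>" "\<beta> < 1" and \<mu>: "0 < \<mu>" and t: "1 \<le> t"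
  shows "prob {\<omega> \<in> space M. (\<Sum>i\<in>I. Z i \<omega>) > t}
    \<le> (1 + card I * K) * exp (- \<mu> * t powr \<beta> + card I * K * \<mu>\<^sup>2 * t powr (2 * \<beta> - 2))"
proof -
  define \<theta> where "\<theta> = \<mu> * t powr (\<beta> - 1)"
  \<comment> \<open>\<open>G i\<close> vanishes beyond \<open>t\<close>, so the product over
    \<open>I\<close> is the exponential of the sum when no summand jumps, and 0 otherwise.\<close>
  define G where "G = (\<lambda>i \<omega>. if Z i \<omega> \<le> t then exp (\<theta> * Z i \<omega>) else 0)"
  have \<theta>: "\<theta> > 0" using \<mu> t by (simp add: \<theta>_def)
  have [measurable]: "Z i \<in> borel_measurable M" if "i \<in> I" for i
    using mean(1)[OF that] by auto
  have indG: "indep_vars (\<lambda>_. borel) G I"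
    unfolding G_def by (rule indep_vars_compose2[OF indep]) measurable
  have G: "integrable M (G i)" "expectation (G i) \<le> exp (\<theta>\<^sup>2 * K)" if "i \<in> I" for i
    using truncated_exponential_moment[OF mean[OF that] int[OF that] K(1)[OF that] \<beta>(2) \<mu>, of t] t
    unfolding G_def \<theta>_def by auto
  have [measurable]: "G i \<in> borel_measurable M" if "i \<in> I" for i
    using G(1)[OF that] by auto
  have G0: "0 \<le> G i \<omega>" for i \<omega> by (simp add: G_def)
  let ?B = "{\<omega> \<in> space M. exp (\<theta> * t) \<le> (\<Prod>i\<in>I. G i \<omega>)}"
  have "prob ?B \<le> expectation (\<lambda>\<omega>. \<Prod>i\<in>I. G i \<omega>) / exp (\<theta> * t)"
    by (intro integral_Markov_inequality_measure[where A = "space M", unfolded Int_absorb2]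
        indep_vars_integrable[OF I indG] G) (auto intro!: prod_nonneg G0)
  also have "expectation (\<lambda>\<omega>. \<Prod>i\<in>I. G i \<omega>) = (\<Prod>i\<in>I. expectation (G i))"
    using I indG G(1) by (rule indep_vars_lebesgue_integral)
  also have "\<dots> \<le> (\<Prod>i\<in>I. exp (\<theta>\<^sup>2 * K))"
    using G(2) G0 by (intro prod_mono) auto
  also have "\<dots> = exp (card I * (\<theta>\<^sup>2 * K))"
    by (simp add: exp_of_nat_mult)
  finally have B: "prob ?B \<le> exp (- \<theta> * t + card I * (\<theta>\<^sup>2 * K))"
    unfolding exp_add mult_minus_left exp_minus by (simp add: divide_inverse mult.commute)
  have \<theta>t: "\<theta> * t = \<mu> * t powr \<beta>"
    using t by (simp add: \<theta>_def powr_diff)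
  have \<theta>2: "\<theta>\<^sup>2 = \<mu>\<^sup>2 * t powr (2 * \<beta> - 2)"
    using t by (simp add: \<theta>_def power_mult_distrib powr_power[symmetric] flip: powr_numeral add: powr_powr algebra_simps)
  let ?T = "exp (- \<mu> * t powr \<beta> + card I * K * \<mu>\<^sup>2 * t powr (2 * \<beta> - 2))"
  have tail: "prob {\<omega> \<in> space M. Z i \<omega> > t} \<le> K * exp (- \<mu> * t powr \<beta>)" if "i \<in> I" for i
    by (rule stretched_exponential_tail[OF _ int[OF that] K(1)[OF that] \<beta>(1) \<mu> t]) (use that in measurable)
  have [measurable]: "(\<lambda>\<omega>. \<Prod>i\<in>I. G i \<omega>) \<in> borel_measurable M"
    by (intro borel_measurable_prod) auto
  have UB: "(\<Union>i\<in>I. {\<omega> \<in> space M. Z i \<omega> > t}) \<in> sets M" "?B \<in> sets M"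
    using I by (auto intro!: sets.finite_UN)
  have "prob {\<omega> \<in> space M. (\<Sum>i\<in>I. Z i \<omega>) > t} \<le> prob ((\<Union>i\<in>I. {\<omega> \<in> space M. Z i \<omega> > t}) \<union> ?B)"
  proof (intro finite_measure_mono subsetI)
    fix \<omega> assume \<omega>: "\<omega> \<in> {\<omega> \<in> space M. (\<Sum>i\<in>I. Z i \<omega>) > t}"
    show "\<omega> \<in> (\<Union>i\<in>I. {\<omega> \<in> space M. Z i \<omega> > t}) \<union> ?B"
    proof (cases "\<exists>i\<in>I. Z i \<omega> > t")
      case False
      then have "(\<Prod>i\<in>I. G i \<omega>) = exp (\<theta> * (\<Sum>i\<in>I. Z i \<omega>))"
        using I by (auto simp: G_def exp_sum sum_distrib_left intro!: prod.cong)
      then show ?thesis using \<omega> \<theta> by auto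
    qed (use \<omega> in auto)
  qed (use UB in auto)
  also have "\<dots> \<le> prob (\<Union>i\<in>I. {\<omega> \<in> space M. Z i \<omega> > t}) + prob ?B"
    by (intro measure_Un_le UB)
  also have "prob (\<Union>i\<in>I. {\<omega> \<in> space M. Z i \<omega> > t}) \<le> (\<Sum>i\<in>I. prob {\<omega> \<in> space M. Z i \<omega> > t})"
    using I by (intro finite_measure_subadditive_finite) auto
  also have "\<dots> \<le> card I * (K * exp (- \<mu> * t powr \<beta>))"
    using tail by (rule sum_bounded_above)
  \<comment> \<open>The single-jump term is weakened to the larger exponential \<open>?T\<close>,
    which also bounds the Markov term.\<close>
  also have "\<dots> \<le> card I * (K * ?T)"
    using K(2) by (intro mult_left_mono) auto
  also have "card I * (K * ?T) + prob ?B \<le> card I * (K * ?T) + ?T"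
    using B \<theta>t \<theta>2 by (simp add: algebra_simps)
  finally show ?thesis by (simp add: algebra_simps)
qed

end

section \<open>From scalar to vector sums: the upper estimate\<close>

text \<open>Each unit vector \<open>u\<close> lies in its own open cap
  \<open>{w. \<rho> < w \<bullet> u}\<close> because \<open>\<rho> < 1\<close>, and compactness of
  the sphere leaves finitely many caps. A norm is thereby replaced by finitely many linear
  functionals at the price of a factor \<open>\<rho>\<close> as close to 1 as desired.\<close>

lemma finite_norming_set:
  fixes \<rho> :: real
  assumes "\<rho> < 1"
  obtains N :: "'b::euclidean_space set"
  where "finite N" "\<And>u. u \<in> N \<Longrightarrow> norm u = 1"
    and "\<And>x. x \<noteq> 0 \<Longrightarrow> \<exists>u\<in>N. \<rho> * norm x < x \<bullet> u"
proof -
  have "compact (sphere (0::'b) 1)" by simp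
  moreover have "open {w. \<rho> < w \<bullet> u}" for u :: 'b
    by (intro open_Collect_less continuous_intros)
  moreover have "sphere (0::'b) 1 \<subseteq> (\<Union>u\<in>sphere 0 1. {w. \<rho> < w \<bullet> u})"
    using assms by (force simp: dot_square_norm)
  ultimately obtain N where N: "N \<subseteq> sphere 0 1" "finite N"
      "sphere (0::'b) 1 \<subseteq> (\<Union>u\<in>N. {w. \<rho> < w \<bullet> u})"
    by (rule compactE_image)
  have "\<exists>u\<in>N. \<rho> * norm x < x \<bullet> u" if "x \<noteq> 0" for x :: 'b
  proof -
    have "x /\<^sub>R norm x \<in> sphere 0 1" using that by simp
    then obtain u where "u \<in> N" "\<rho> < (x /\<^sub>R norm x) \<bullet> u" using N(3) by blast
    with that show ?thesis by (auto simp: field_simps)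
  qed
  with N show ?thesis by (intro that[of N]) auto
qed

context prob_space
begin

text \<open>A union bound over the norming directions, with the scalar estimate applied to each
  projection. \<open>C\<close> counts the directions and \<open>K\<close> is the weighted second
  moment of \<open>Y\<^sub>0\<close>; both are fixed before \<open>I\<close>, \<open>Y\<close>,
  \<open>n\<close> and \<open>t\<close>, so the estimate is uniform in them.\<close>

lemma norm_sum_tail_bound:
  fixes Y\<^sub>0 :: "'a \<Rightarrow> 'b::euclidean_space" and \<mu> \<beta> \<rho> :: real
  assumes int: "integrable M Y\<^sub>0" and mean: "expectation Y\<^sub>0 = 0"
    and moment: "integrable M (\<lambda>\<omega>. (norm (Y\<^sub>0 \<omega>))\<^sup>2 * exp (\<mu> * norm (Y\<^sub>0 \<omega>) powr \<beta>))"
    and \<beta>: "0 < \<beta>" "\<beta> < 1" and \<mu>: "0 < \<mu>" and \<rho>: "0 < \<rho>" "\<rho> < 1"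
  shows "\<exists>C K. 0 \<le> C \<and> 0 \<le> K \<and> (\<forall>(I :: 'i set) Y n t.
      finite I \<longrightarrow> card I \<le> n \<longrightarrow> indep_vars (\<lambda>_. borel) Y I \<longrightarrow>
      (\<forall>i\<in>I. distr M borel (Y i) = distr M borel Y\<^sub>0) \<longrightarrow> 1 \<le> \<rho> * t \<longrightarrow>
      prob {\<omega> \<in> space M. norm (\<Sum>i\<in>I. Y i \<omega>) > t} \<le> C * (1 + real n * K) *
        exp (- \<mu> * (\<rho> * t) powr \<beta> + real n * K * \<mu>\<^sup>2 * (\<rho> * t) powr (2 * \<beta> - 2)))"
proof -
  let ?m = "\<lambda>y :: 'b. (norm y)\<^sup>2 * exp (\<mu> * norm y powr \<beta>)"
  define K where "K = expectation (\<lambda>\<omega>. ?m (Y\<^sub>0 \<omega>))"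
  have K: "0 \<le> K" unfolding K_def by (intro integral_nonneg_AE) simp
  obtain N :: "'b set" where N: "finite N" "\<And>u. u \<in> N \<Longrightarrow> norm u = 1"
      "\<And>x. x \<noteq> 0 \<Longrightarrow> \<exists>u\<in>N. \<rho> * norm x < x \<bullet> u"
    using finite_norming_set[OF \<rho>(2)] by metis
  have [measurable]: "Y\<^sub>0 \<in> borel_measurable M" using int by auto
  show ?thesis
  proof (rule exI[of _ "real (card N)"], rule exI[of _ K], intro conjI allI impI)
    fix I :: "'i set" and Y n t
    assume I: "finite I" "card I \<le> n" and indep: "indep_vars (\<lambda>_. borel) Y I"
      and dist': "\<forall>i\<in>I. distr M borel (Y i) = distr M borel Y\<^sub>0" and t: "1 \<le> \<rho> * t"
    note dist = bspec[OF dist']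
    have Y [measurable]: "Y i \<in> borel_measurable M" if "i \<in> I" for i
      using indep that by (auto simp: indep_vars_def)
    \<comment> \<open>Moments are assumed for \<open>Y\<^sub>0\<close>; the common law carries them
      to every \<open>Y i\<close>.\<close>
    have transfer_int: "integrable M (\<lambda>\<omega>. f (Y i \<omega>)) \<longleftrightarrow> integrable M (\<lambda>\<omega>. f (Y\<^sub>0 \<omega>))"
      if "i \<in> I" "f \<in> borel_measurable borel" for i and f :: "'b \<Rightarrow> real"
      using that dist[OF that(1)] integrable_distr_eq[OF Y[OF that(1)] that(2)]
        integrable_distr_eq[of Y\<^sub>0 M borel f] by simp
    have transfer: "expectation (\<lambda>\<omega>. f (Y i \<omega>)) = expectation (\<lambda>\<omega>. f (Y\<^sub>0 \<omega>))"
      if "i \<in> I" "f \<in> borel_measurable borel" for i and f :: "'b \<Rightarrow> real"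
      using that dist[OF that(1)] integral_distr[OF Y[OF that(1)] that(2)]
        integral_distr[of Y\<^sub>0 M borel f] by simp
    let ?E = "exp (- \<mu> * (\<rho> * t) powr \<beta> + n * K * \<mu>\<^sup>2 * (\<rho> * t) powr (2 * \<beta> - 2))"
    have dir: "prob {\<omega> \<in> space M. (\<Sum>i\<in>I. Y i \<omega> \<bullet> u) > \<rho> * t} \<le> (1 + n * K) * ?E" if "u \<in> N" for u
    proof -
      let ?g = "\<lambda>y. (y \<bullet> u)\<^sup>2 * exp (\<mu> * \<bar>y \<bullet> u\<bar> powr \<beta>)"
      \<comment> \<open>By Cauchy-Schwarz the projected moment is dominated by that of the norm, so
        a single \<open>K\<close> serves all directions.\<close>
      have le: "?g y \<le> ?m y" for y
      proof -
        have "\<bar>y \<bullet> u\<bar> \<le> norm y" using Cauchy_Schwarz_ineq2[of y u] N(2)[OF that] by simp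
        then have "(y \<bullet> u)\<^sup>2 \<le> (norm y)\<^sup>2" and "\<bar>y \<bullet> u\<bar> powr \<beta> \<le> norm y powr \<beta>"
          using \<beta> by (auto intro: powr_mono2 simp: abs_le_square_iff[symmetric])
        then show ?thesis using \<mu> by (intro mult_mono) auto
      qed
      have g: "integrable M (\<lambda>\<omega>. ?g (Y\<^sub>0 \<omega>))"
        by (rule Bochner_Integration.integrable_bound[OF moment]) (use le in auto)
      have "prob {\<omega> \<in> space M. (\<Sum>i\<in>I. Y i \<omega> \<bullet> u) > \<rho> * t}
          \<le> (1 + card I * K) * exp (- \<mu> * (\<rho> * t) powr \<beta> + card I * K * \<mu>\<^sup>2 * (\<rho> * t) powr (2 * \<beta> - 2))"
      proof (rule truncated_chernoff[OF I(1) _ _ _ _ _ K \<beta> \<mu> t])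
        show "indep_vars (\<lambda>_. borel) (\<lambda>i \<omega>. Y i \<omega> \<bullet> u) I"
          by (rule indep_vars_compose2[OF indep]) measurable
        fix i assume i: "i \<in> I"
        show "integrable M (\<lambda>\<omega>. Y i \<omega> \<bullet> u)"
          using transfer_int[OF i, of "\<lambda>y. y \<bullet> u"] int by auto
        show "expectation (\<lambda>\<omega>. Y i \<omega> \<bullet> u) = 0"
          using transfer[OF i, of "\<lambda>y. y \<bullet> u"] int mean by simp
        show "integrable M (\<lambda>\<omega>. ?g (Y i \<omega>))"
          using transfer_int[OF i, of ?g] g by simp
        show "expectation (\<lambda>\<omega>. ?g (Y i \<omega>)) \<le> K"
          using transfer[OF i, of ?g] integral_mono[OF g moment] le by (simp add: K_def)
      qed
      also have "\<dots> \<le> (1 + n * K) * ?E"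
        using I K by (intro mult_mono) (auto intro!: mult_right_mono)
      finally show ?thesis .
    qed
    have "prob {\<omega> \<in> space M. norm (\<Sum>i\<in>I. Y i \<omega>) > t}
        \<le> prob (\<Union>u\<in>N. {\<omega> \<in> space M. (\<Sum>i\<in>I. Y i \<omega> \<bullet> u) > \<rho> * t})"
    proof (intro finite_measure_mono subsetI)
      fix \<omega> assume \<omega>: "\<omega> \<in> {\<omega> \<in> space M. norm (\<Sum>i\<in>I. Y i \<omega>) > t}"
      \<comment> \<open>Positivity of \<open>t\<close> excludes the zero vector, to which the
        norming set assigns no direction.\<close>
      have "t > 0" using t \<rho> by (metis less_le_trans zero_less_mult_pos zero_less_one)
      with \<omega> have "(\<Sum>i\<in>I. Y i \<omega>) \<noteq> 0" by auto
      then obtain u where u: "u \<in> N" "\<rho> * norm (\<Sum>i\<in>I. Y i \<omega>) < (\<Sum>i\<in>I. Y i \<omega>) \<bullet> u"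
        using N(3) by blast
      moreover have "\<rho> * t < \<rho> * norm (\<Sum>i\<in>I. Y i \<omega>)" using \<omega> \<rho> by simp
      ultimately show "\<omega> \<in> (\<Union>u\<in>N. {\<omega> \<in> space M. (\<Sum>i\<in>I. Y i \<omega> \<bullet> u) > \<rho> * t})"
        using \<omega> by (auto simp: inner_sum_left intro!: bexI[of _ u])
    qed (use N in \<open>auto intro!: sets.finite_UN\<close>)
    also have "\<dots> \<le> (\<Sum>u\<in>N. prob {\<omega> \<in> space M. (\<Sum>i\<in>I. Y i \<omega> \<bullet> u) > \<rho> * t})"
      using N by (intro finite_measure_subadditive_finite) auto
    also have "\<dots> \<le> card N * ((1 + n * K) * ?E)"
      using dir by (rule sum_bounded_above)
    finally show "prob {\<omega> \<in> space M. norm (\<Sum>i\<in>I. Y i \<omega>) > t} \<le> card N * (1 + n * K) * ?E"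
      by (simp add: mult.assoc)
  qed (use K in auto)
qed

end

text \<open>The gap \<open>m - m'\<close> is spent in two halves: one beats the linear prefactor,
  the other beats the correction, which is \<open>k * n powr (\<beta> - 1)\<close> times
  \<open>n powr \<beta>\<close> with a first factor tending to 0.\<close>

lemma stretched_exponential_absorbs:
  fixes C K k m m' \<beta> :: real
  assumes "0 < \<beta>" "\<beta> < 1" "m' < m" "0 \<le> C" "0 \<le> K"
  shows "eventually (\<lambda>n. C * (1 + n * K) * exp (- m * n powr \<beta> + k * n powr (2 * \<beta> - 1))
    \<le> exp (- m' * n powr \<beta>)) at_top"
proof -
  have "((\<lambda>n. (C + C * K * n) * exp (- ((m - m') / 2) * n powr \<beta>)) \<longlongrightarrow> 0) at_top"
  proof -
    define e where "e = (m - m') / 2"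
    have "e > 0" using assms by (simp add: e_def)
    then have "((\<lambda>n. C * exp (- e * n powr \<beta>) + C * K * (n * exp (- e * n powr \<beta>))) \<longlongrightarrow> C * 0 + C * K * 0) at_top"
      using assms(1) by (intro tendsto_intros; real_asymp)
    then show ?thesis by (simp add: e_def algebra_simps)
  qed
  then have 1: "eventually (\<lambda>n. (C + C * K * n) * exp (- ((m - m') / 2) * n powr \<beta>) < 1) at_top"
    by (rule order_tendstoD) simp
  have "((\<lambda>n. k * n powr (\<beta> - 1)) \<longlongrightarrow> k * 0) at_top"
    using assms(2) by (intro tendsto_intros tendsto_neg_powr filterlim_ident) auto
  then have 2: "eventually (\<lambda>n. k * n powr (\<beta> - 1) < (m - m') / 2) at_top"
    by (rule order_tendstoD) (use assms in simp)
  show ?thesis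
    using 1 2 eventually_gt_at_top[of 0]
  proof eventually_elim
    case (elim n)
    have "k * n powr (2 * \<beta> - 1) = (k * n powr (\<beta> - 1)) * n powr \<beta>"
      by (simp add: powr_add[symmetric] mult.assoc)
    also have "\<dots> \<le> (m - m') / 2 * n powr \<beta>"
      using elim by (intro mult_right_mono) auto
    finally have "C * (1 + n * K) * exp (- m * n powr \<beta> + k * n powr (2 * \<beta> - 1))
        \<le> C * (1 + n * K) * exp (- ((m - m') / 2) * n powr \<beta> - m' * n powr \<beta>)"
      using assms elim by (intro mult_left_mono) (auto simp: field_simps)
    also have "\<dots> = ((C + C * K * n) * exp (- ((m - m') / 2) * n powr \<beta>)) * exp (- m' * n powr \<beta>)"
    proof -
      have "C * (1 + n * K) = C + C * K * n" by (simp add: algebra_simps)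
      moreover have "exp (x - y) = exp x * exp (- y)" for x y :: real
        by (simp add: exp_diff exp_minus divide_inverse)
      ultimately show ?thesis by (simp only: mult.assoc mult_minus_left)
    qed
    also have "\<dots> \<le> 1 * exp (- m' * n powr \<beta>)"
      using elim by (intro mult_right_mono) auto
    finally show ?case by simp
  qed
qed

context prob_space
begin

text \<open>The strict inequality for \<open>m\<close> leaves room for the loss in the moment
  condition, for the loss in the norming set and for the prefactor. Uniformity over all index sets
  of at most \<open>n\<close> elements lets the same estimate handle the full sum and the sum
  without its first term.\<close>

lemma norm_sum_tail_upper:
  fixes Y\<^sub>0 :: "'a \<Rightarrow> 'b::euclidean_space" and \<gamma> \<beta> s m :: real
  assumes int: "integrable M Y\<^sub>0" and mean: "expectation Y\<^sub>0 = 0"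
    and moment: "\<And>\<mu>. \<lbrakk>0 < \<mu>; \<mu> < \<gamma>\<rbrakk> \<Longrightarrow>
      integrable M (\<lambda>\<omega>. (norm (Y\<^sub>0 \<omega>))\<^sup>2 * exp (\<mu> * norm (Y\<^sub>0 \<omega>) powr \<beta>))"
    and \<beta>: "0 < \<beta>" "\<beta> < 1" and "0 < \<gamma>" and s: "0 < s" and m: "m < \<gamma> * s powr \<beta>"
  shows "eventually (\<lambda>n. \<forall>(I :: 'i set) Y. finite I \<longrightarrow> card I \<le> n \<longrightarrow> indep_vars (\<lambda>_. borel) Y I \<longrightarrow>
      (\<forall>i\<in>I. distr M borel (Y i) = distr M borel Y\<^sub>0) \<longrightarrow>
      prob {\<omega> \<in> space M. norm (\<Sum>i\<in>I. Y i \<omega>) > n * s} \<le> exp (- m * n powr \<beta>)) sequentially"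
proof -
  \<comment> \<open>One parameter serves twice: \<open>\<rho>\<close> is the loss of the norming
    set, and \<open>\<rho> * \<gamma>\<close> is the exponent at which the moment is taken. By
    continuity at 1 the resulting rate still exceeds \<open>m\<close>.\<close>
  have "((\<lambda>\<rho>. (\<rho> * \<gamma>) * (\<rho> * s) powr \<beta>) \<longlongrightarrow> (1 * \<gamma>) * (1 * s) powr \<beta>) (at_left 1)"
    using s by (intro tendsto_intros) auto
  then have "eventually (\<lambda>\<rho>. m < (\<rho> * \<gamma>) * (\<rho> * s) powr \<beta>) (at_left 1)"
    by (rule order_tendstoD) (use m in simp)
  moreover have "eventually (\<lambda>\<rho>. \<rho> \<in> {0<..<1}) (at_left (1::real))"
    by (rule eventually_at_left_real) simp
  ultimately have "eventually (\<lambda>\<rho>. m < (\<rho> * \<gamma>) * (\<rho> * s) powr \<beta> \<and> \<rho> \<in> {0<..<1}) (at_left 1)"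
    by (rule eventually_conj)
  from eventually_happens'[OF trivial_limit_at_left_real this]
  obtain \<rho> where \<rho>: "0 < \<rho>" "\<rho> < 1" "m < (\<rho> * \<gamma>) * (\<rho> * s) powr \<beta>"
    by auto
  define \<mu> where "\<mu> = \<rho> * \<gamma>"
  have \<mu>: "0 < \<mu>" "\<mu> < \<gamma>" using \<rho> \<open>0 < \<gamma>\<close> by (auto simp: \<mu>_def)
  obtain C K :: real where C: "0 \<le> C" "0 \<le> K"
    and bound: "\<forall>(I :: 'i set) Y n t.
      finite I \<longrightarrow> card I \<le> n \<longrightarrow> indep_vars (\<lambda>_. borel) Y I \<longrightarrow>
      (\<forall>i\<in>I. distr M borel (Y i) = distr M borel Y\<^sub>0) \<longrightarrow> 1 \<le> \<rho> * t \<longrightarrow>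
      prob {\<omega> \<in> space M. norm (\<Sum>i\<in>I. Y i \<omega>) > t} \<le> C * (1 + real n * K) *
        exp (- \<mu> * (\<rho> * t) powr \<beta> + real n * K * \<mu>\<^sup>2 * (\<rho> * t) powr (2 * \<beta> - 2))"
    using norm_sum_tail_bound[OF int mean moment[OF \<mu>] \<beta> \<mu>(1) \<rho>(1,2), where 'i = 'i] by blast
  \<comment> \<open>With \<open>t = n * s\<close> the factor \<open>n\<close> of the correction
    raises the exponent \<open>2 * \<beta> - 2\<close> to \<open>2 * \<beta> - 1\<close>.\<close>
  have "eventually (\<lambda>n. C * (1 + n * K) * exp (- (\<mu> * (\<rho> * s) powr \<beta>) * n powr \<beta>
      + (K * \<mu>\<^sup>2 * (\<rho> * s) powr (2 * \<beta> - 2)) * n powr (2 * \<beta> - 1)) \<le> exp (- m * n powr \<beta>)) at_top"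
    using \<rho>(3) by (intro stretched_exponential_absorbs \<beta> C) (simp add: \<mu>_def)
  then have "eventually (\<lambda>n::nat. C * (1 + n * K) * exp (- (\<mu> * (\<rho> * s) powr \<beta>) * n powr \<beta>
      + (K * \<mu>\<^sup>2 * (\<rho> * s) powr (2 * \<beta> - 2)) * n powr (2 * \<beta> - 1)) \<le> exp (- m * n powr \<beta>)) sequentially"
    by (rule eventually_compose_filterlim[OF _ filterlim_real_sequentially])
  \<comment> \<open>From this \<open>n\<close> on, the truncation level
    \<open>\<rho> * (n * s)\<close> is at least 1, as the scalar tail estimate requires.\<close>
  moreover have "eventually (\<lambda>n::nat. 1 / (\<rho> * s) \<le> n) sequentially"
    by (rule eventually_compose_filterlim[OF eventually_ge_at_top filterlim_real_sequentially])
  moreover have "eventually (\<lambda>n::nat. 0 < n) sequentially" by (rule eventually_gt_at_top)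
  ultimately show ?thesis
  proof eventually_elim
    case (elim n)
    show ?case
    proof (intro allI impI)
      fix I :: "'i set" and Y
      assume I: "finite I" "card I \<le> n" "indep_vars (\<lambda>_. borel) Y I"
        "\<forall>i\<in>I. distr M borel (Y i) = distr M borel Y\<^sub>0"
      have "1 \<le> \<rho> * (n * s)" using elim(2) \<rho> s by (simp add: field_simps)
      with I have "prob {\<omega> \<in> space M. norm (\<Sum>i\<in>I. Y i \<omega>) > n * s} \<le> C * (1 + n * K) *
          exp (- \<mu> * (\<rho> * (n * s)) powr \<beta> + n * K * \<mu>\<^sup>2 * (\<rho> * (n * s)) powr (2 * \<beta> - 2))"
        by (intro bound[rule_format]) auto
      also have "- \<mu> * (\<rho> * (n * s)) powr \<beta> = - (\<mu> * (\<rho> * s) powr \<beta>) * n powr \<beta>"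
        using \<rho> s by (simp add: powr_mult algebra_simps)
      also have "n * K * \<mu>\<^sup>2 * (\<rho> * (n * s)) powr (2 * \<beta> - 2)
          = (K * \<mu>\<^sup>2 * (\<rho> * s) powr (2 * \<beta> - 2)) * (n * n powr (2 * \<beta> - 2))"
        using \<rho> s by (simp add: powr_mult algebra_simps)
      also have "n * n powr (2 * \<beta> - 2) = n powr (2 * \<beta> - 1)"
        using elim(3) by (simp add: powr_mult_base)
      finally show "prob {\<omega> \<in> space M. norm (\<Sum>i\<in>I. Y i \<omega>) > n * s} \<le> exp (- m * n powr \<beta>)"
        using elim(1) by linarith
    qed
  qed
qed

end

section \<open>One big jump and the logarithmic rate\<close>

text \<open>Exponential estimates are asked for strictly on either side of \<open>l\<close>, so that
  every slack introduced in the probability estimates can be absorbed before the limit is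
  taken.\<close>

lemma ln_div_tendsto:
  fixes p g :: "nat \<Rightarrow> real"
  assumes upper: "\<And>m. m < l \<Longrightarrow> eventually (\<lambda>n. p n \<le> exp (- m * g n)) sequentially"
    and lower: "\<And>m. l < m \<Longrightarrow> eventually (\<lambda>n. exp (- m * g n) \<le> p n) sequentially"
    and g: "eventually (\<lambda>n. 0 < g n) sequentially"
  shows "(\<lambda>n. ln (p n) / g n) \<longlonglongrightarrow> - l"
proof (rule order_tendstoI)
  \<comment> \<open>The lower estimate keeps \<open>p n\<close> away from the arguments at which
    \<open>ln\<close> is only a default value.\<close>
  have pos: "eventually (\<lambda>n. 0 < p n) sequentially"
    using lower[of "l + 1"] by (rule eventually_mono) (auto intro: less_le_trans[OF exp_gt_zero])
  {
    fix b assume "b < - l"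
    then obtain b' where b': "b < b'" "b' < - l" using dense by blast
    then have "eventually (\<lambda>n. exp (- (- b') * g n) \<le> p n) sequentially" by (intro lower) simp
    then show "eventually (\<lambda>n. b < ln (p n) / g n) sequentially"
      using pos g
    proof eventually_elim
      case (elim n)
      then have "b' * g n \<le> ln (p n)" by (simp add: ln_ge_iff)
      then have "b' \<le> ln (p n) / g n" using elim by (simp add: field_simps)
      with b' show ?case by simp
    qed
  next
    fix b assume "- l < b"
    then obtain b' where b': "- l < b'" "b' < b" using dense by blast
    then have "eventually (\<lambda>n. p n \<le> exp (- (- b') * g n)) sequentially" by (intro upper) simp
    then show "eventually (\<lambda>n. ln (p n) / g n < b) sequentially"
      using pos g
    proof eventually_elim
      case (elim n)
      then have "ln (p n) \<le> b' * g n" by (metis ln_exp ln_mono minus_minus)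
      then have "ln (p n) / g n \<le> b'" using elim by (simp add: field_simps)
      with b' show ?case by simp
    qed
  }
qed

context prob_space
begin

text \<open>Separates one increment from the rest: the restrictions of the family to
  \<open>{i}\<close> and to \<open>I\<close> are independent, and both variables are measurable
  functions of them.\<close>

lemma indep_var_sum_euclidean:
  fixes Y :: "'i \<Rightarrow> 'a \<Rightarrow> 'b::euclidean_space"
  assumes I: "finite I" "i \<notin> I" and indep: "indep_vars (\<lambda>_. borel) Y (insert i I)"
  shows "indep_var borel (Y i) borel (\<lambda>\<omega>. \<Sum>j\<in>I. Y j \<omega>)"
proof -
  have "indep_var
    borel ((\<lambda>f. f i) \<circ> (\<lambda>\<omega>. restrict (\<lambda>j. Y j \<omega>) {i}))
    borel ((\<lambda>f. \<Sum>j\<in>I. f j) \<circ> (\<lambda>\<omega>. restrict (\<lambda>j. Y j \<omega>) I))"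
    using I by (intro indep_var_compose[OF indep_var_restrict[OF indep]]) auto
  also have "((\<lambda>f. f i) \<circ> (\<lambda>\<omega>. restrict (\<lambda>j. Y j \<omega>) {i})) = Y i"
    by auto
  also have "((\<lambda>f. \<Sum>j\<in>I. f j) \<circ> (\<lambda>\<omega>. restrict (\<lambda>j. Y j \<omega>) I)) = (\<lambda>\<omega>. \<Sum>j\<in>I. Y j \<omega>)"
    by (auto cong: rev_conj_cong)
  finally show ?thesis .
qed

text \<open>A jump longer than \<open>s + r\<close> cannot be brought back to length
  \<open>s\<close> by a remainder of length at most \<open>r\<close>; independence of the two events
  produces the product.\<close>

lemma prob_one_big_jump:
  fixes Y :: "'i \<Rightarrow> 'a \<Rightarrow> 'b::euclidean_space"
  assumes I: "finite I" "i \<notin> I" and indep: "indep_vars (\<lambda>_. borel) Y (insert i I)"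
  shows "prob {\<omega> \<in> space M. norm (Y i \<omega>) > s + r} * (1 - prob {\<omega> \<in> space M. norm (\<Sum>j\<in>I. Y j \<omega>) > r})
    \<le> prob {\<omega> \<in> space M. norm (\<Sum>j\<in>insert i I. Y j \<omega>) > s}"
proof -
  have Y [measurable]: "Y j \<in> borel_measurable M" if "j \<in> insert i I" for j
    using indep that by (auto simp: indep_vars_def)
  have [measurable]: "Y i \<in> borel_measurable M" by (rule Y) simp
  have [measurable]: "(\<lambda>\<omega>. \<Sum>j\<in>I. Y j \<omega>) \<in> borel_measurable M"
    by (intro borel_measurable_sum Y) simp
  have sets: "{y :: 'b. norm y > s + r} \<in> sets borel" "{y :: 'b. \<not> norm y > r} \<in> sets borel"
    by measurable
  have "1 - prob {\<omega> \<in> space M. norm (\<Sum>j\<in>I. Y j \<omega>) > r}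
      = prob {\<omega> \<in> space M. \<not> norm (\<Sum>j\<in>I. Y j \<omega>) > r}"
    by (rule prob_neg[symmetric]) measurable
  then have "prob {\<omega> \<in> space M. norm (Y i \<omega>) > s + r} * (1 - prob {\<omega> \<in> space M. norm (\<Sum>j\<in>I. Y j \<omega>) > r})
      = prob ((\<lambda>\<omega>. (Y i \<omega>, \<Sum>j\<in>I. Y j \<omega>)) -` ({y. norm y > s + r} \<times> {y. \<not> norm y > r}) \<inter> space M)"
    unfolding indep_varD[OF indep_var_sum_euclidean[OF I indep] sets]
    by (simp add: vimage_def Int_def conj_commute)
  also have "\<dots> \<le> prob {\<omega> \<in> space M. norm (\<Sum>j\<in>insert i I. Y j \<omega>) > s}"
  proof (intro finite_measure_mono subsetI)
    fix \<omega> assume "\<omega> \<in> (\<lambda>\<omega>. (Y i \<omega>, \<Sum>j\<in>I. Y j \<omega>)) -` ({y. norm y > s + r} \<times> {y. \<not> norm y > r}) \<inter> space M"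
    then show "\<omega> \<in> {\<omega> \<in> space M. norm (\<Sum>j\<in>insert i I. Y j \<omega>) > s}"
      using I norm_triangle_ineq4[of "Y i \<omega> + (\<Sum>j\<in>I. Y j \<omega>)" "\<Sum>j\<in>I. Y j \<omega>"] by simp
  qed (use I in simp)
  finally show ?thesis .
qed

text \<open>Moments below the critical exponent \<open>\<gamma>\<close> yield the upper estimate,
  and tails above it the lower one. Neither is assumed at \<open>\<gamma>\<close> itself, since the
  limit only calls for strict rates.\<close>

theorem stretched_exponential_large_deviation:
  fixes Y :: "nat \<Rightarrow> 'a \<Rightarrow> 'b::euclidean_space" and \<gamma> \<beta> a :: real
  assumes indep: "indep_vars (\<lambda>_. borel) Y {1..}"
    and dist: "\<And>i. 1 \<le> i \<Longrightarrow> distr M borel (Y i) = distr M borel Y\<^sub>0"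
    and int: "integrable M Y\<^sub>0" and mean: "expectation Y\<^sub>0 = 0"
    and moment: "\<And>\<mu>. \<lbrakk>0 < \<mu>; \<mu> < \<gamma>\<rbrakk> \<Longrightarrow>
      integrable M (\<lambda>\<omega>. (norm (Y\<^sub>0 \<omega>))\<^sup>2 * exp (\<mu> * norm (Y\<^sub>0 \<omega>) powr \<beta>))"
    and tail: "\<And>\<nu>. \<gamma> < \<nu> \<Longrightarrow>
      eventually (\<lambda>x. exp (- \<nu> * x powr \<beta>) \<le> prob {\<omega> \<in> space M. norm (Y\<^sub>0 \<omega>) > x}) at_top"
    and \<beta>: "0 < \<beta>" "\<beta> < 1" and \<gamma>: "0 < \<gamma>" and a: "0 < a"
  shows "(\<lambda>n. ln (prob {\<omega> \<in> space M. norm (\<Sum>i=1..n. Y i \<omega>) > n * a}) / n powr \<beta>)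
    \<longlonglongrightarrow> - (\<gamma> * a powr \<beta>)"
proof -
  \<comment> \<open>The first index is left free: \<open>k = 1\<close> gives the upper estimate of
    the theorem, \<open>k = 2\<close> controls the remainder once the first increment has
    jumped.\<close>
  have upper: "eventually (\<lambda>n. prob {\<omega> \<in> space M. norm (\<Sum>i\<in>{k..n}. Y i \<omega>) > n * s}
      \<le> exp (- m * n powr \<beta>)) sequentially"
    if "0 < s" "m < \<gamma> * s powr \<beta>" "1 \<le> k" for s m :: real and k :: nat
  proof -
    have indep': "indep_vars (\<lambda>_. borel) Y {k..n}" for n
      by (rule indep_vars_subset[OF indep]) (use that in auto)
    have "eventually (\<lambda>n. \<forall>(I :: nat set) Y. finite I \<longrightarrow> card I \<le> n \<longrightarrow> indep_vars (\<lambda>_. borel) Y I \<longrightarrow>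
        (\<forall>i\<in>I. distr M borel (Y i) = distr M borel Y\<^sub>0) \<longrightarrow>
        prob {\<omega> \<in> space M. norm (\<Sum>i\<in>I. Y i \<omega>) > n * s} \<le> exp (- m * n powr \<beta>)) sequentially"
      using that by (intro norm_sum_tail_upper[OF int mean moment \<beta> \<gamma>])
    then show ?thesis
    proof eventually_elim
      case (elim n)
      show ?case
        by (rule elim[rule_format]) (use that dist indep' in auto)
    qed
  qed
  show ?thesis
  proof (rule ln_div_tendsto)
    show "eventually (\<lambda>n. 0 < real n powr \<beta>) sequentially"
      using eventually_gt_at_top[of 0] by eventually_elim simp
  next
    fix m assume "m < \<gamma> * a powr \<beta>"
    then show "eventually (\<lambda>n. prob {\<omega> \<in> space M. norm (\<Sum>i=1..n. Y i \<omega>) > n * a} \<le> exp (- m * n powr \<beta>)) sequentially"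
      using a by (intro upper) auto
  next
    fix m assume m: "\<gamma> * a powr \<beta> < m"
    \<comment> \<open>\<open>\<delta>\<close> is slack both in the exponent and in the length of the
      jump; continuity keeps the combined rate below \<open>m\<close>.\<close>
    have "((\<lambda>\<delta>. (\<gamma> + \<delta>) * (a + \<delta>) powr \<beta>) \<longlongrightarrow> (\<gamma> + 0) * (a + 0) powr \<beta>) (at_right 0)"
      using a by (intro tendsto_intros) auto
    then have "eventually (\<lambda>\<delta>. (\<gamma> + \<delta>) * (a + \<delta>) powr \<beta> < m) (at_right 0)"
      by (rule order_tendstoD) (use m in simp)
    moreover have "eventually (\<lambda>\<delta>. 0 < \<delta>) (at_right (0::real))"
      by (rule eventually_at_right_less)
    ultimately have "eventually (\<lambda>\<delta>. (\<gamma> + \<delta>) * (a + \<delta>) powr \<beta> < m \<and> 0 < \<delta>) (at_right 0)"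
      by (rule eventually_conj)
    from eventually_happens'[OF trivial_limit_at_right_real this]
    obtain \<delta> where \<delta>: "0 < \<delta>" "(\<gamma> + \<delta>) * (a + \<delta>) powr \<beta> < m"
      by auto
    define m' where "m' = (\<gamma> + \<delta>) * (a + \<delta>) powr \<beta>"
    have "eventually (\<lambda>x. exp (- (\<gamma> + \<delta>) * x powr \<beta>) \<le> prob {\<omega> \<in> space M. norm (Y\<^sub>0 \<omega>) > x}) at_top"
      using \<delta> by (intro tail) simp
    moreover have "filterlim (\<lambda>n. real n * (a + \<delta>)) at_top sequentially"
      using a \<delta> by (intro filterlim_at_top_mult_tendsto_pos[OF tendsto_const _ filterlim_real_sequentially]) simp
    ultimately have jump: "eventually (\<lambda>n. exp (- (\<gamma> + \<delta>) * (real n * (a + \<delta>)) powr \<beta>)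
        \<le> prob {\<omega> \<in> space M. norm (Y\<^sub>0 \<omega>) > real n * (a + \<delta>)}) sequentially"
      by (rule eventually_compose_filterlim)
    \<comment> \<open>A positive rate below \<open>\<gamma> * \<delta> powr \<beta>\<close>, at
      which the remainder exceeds \<open>n * \<delta>\<close> with vanishing probability.\<close>
    define q where "q = \<gamma> * \<delta> powr \<beta> / 2"
    have q: "0 < q" "q < \<gamma> * \<delta> powr \<beta>" using \<gamma> \<delta> by (auto simp: q_def)
    have rest: "eventually (\<lambda>n. prob {\<omega> \<in> space M. norm (\<Sum>i\<in>{2..n}. Y i \<omega>) > n * \<delta>} \<le> exp (- q * n powr \<beta>)) sequentially"
      using q \<delta> by (intro upper) auto
    have "((\<lambda>n. exp (- q * real n powr \<beta>)) \<longlongrightarrow> 0) sequentially"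
      using q \<beta> by real_asymp
    then have half: "eventually (\<lambda>n. exp (- q * real n powr \<beta>) < 1 / 2) sequentially"
      by (rule order_tendstoD) simp
    \<comment> \<open>The gap \<open>m - m'\<close> pays for the event that the remainder is small:
      its exponential is eventually below 1/2, while that event has probability above 1/2.\<close>
    have "((\<lambda>n. exp (- (m - m') * real n powr \<beta>)) \<longlongrightarrow> 0) sequentially"
    proof -
      define e where "e = m - m'"
      have "e > 0" using \<delta> by (simp add: e_def m'_def)
      then show ?thesis unfolding e_def[symmetric] using \<beta> by real_asymp
    qed
    then have gap: "eventually (\<lambda>n. exp (- (m - m') * real n powr \<beta>) < 1 / 2) sequentially"
      by (rule order_tendstoD) simp
    show "eventually (\<lambda>n. exp (- m * n powr \<beta>) \<le> prob {\<omega> \<in> space M. norm (\<Sum>i=1..n. Y i \<omega>) > n * a}) sequentially"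
      using jump rest half gap eventually_gt_at_top[of 0]
    proof eventually_elim
      case (elim n)
      have [measurable]: "Y (Suc 0) \<in> borel_measurable M" "Y\<^sub>0 \<in> borel_measurable M"
        using indep int by (auto simp: indep_vars_def)
      \<comment> \<open>Needs \<open>n > 0\<close>: for \<open>n = 0\<close> the left side is
        \<open>{1}\<close> and the right side is empty.\<close>
      have ins: "insert 1 {2..n} = {1..n}" using elim(5) by auto
      have "- m * n powr \<beta> = - m' * n powr \<beta> + - (m - m') * n powr \<beta>"
        by (simp add: algebra_simps)
      then have "exp (- m * n powr \<beta>) = exp (- m' * n powr \<beta>) * exp (- (m - m') * n powr \<beta>)"
        by (simp only: exp_add)
      also have "\<dots> \<le> exp (- m' * n powr \<beta>) * (1 - exp (- q * n powr \<beta>))"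
        using elim(3,4) by (intro mult_left_mono) auto
      also have "exp (- m' * n powr \<beta>) = exp (- (\<gamma> + \<delta>) * (n * (a + \<delta>)) powr \<beta>)"
        using a \<delta> by (simp add: m'_def powr_mult mult_ac del: minus_add_distrib)
      also have "\<dots> * (1 - exp (- q * n powr \<beta>)) \<le> prob {\<omega> \<in> space M. norm (Y\<^sub>0 \<omega>) > n * (a + \<delta>)}
          * (1 - prob {\<omega> \<in> space M. norm (\<Sum>i\<in>{2..n}. Y i \<omega>) > n * \<delta>})"
        using elim(1-3) q by (intro mult_mono) auto
      also have "prob {\<omega> \<in> space M. norm (Y\<^sub>0 \<omega>) > n * (a + \<delta>)}
          = measure (distr M borel Y\<^sub>0) {y. norm y > n * (a + \<delta>)}"
        by (subst measure_distr) (auto simp: vimage_def Int_def conj_commute)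
      also have "\<dots> = measure (distr M borel (Y 1)) {y. norm y > n * (a + \<delta>)}"
        using dist[of 1] by simp
      also have "\<dots> = prob {\<omega> \<in> space M. norm (Y 1 \<omega>) > n * a + n * \<delta>}"
        by (subst measure_distr) (auto simp: vimage_def Int_def conj_commute algebra_simps)
      also have "\<dots> * (1 - prob {\<omega> \<in> space M. norm (\<Sum>i\<in>{2..n}. Y i \<omega>) > n * \<delta>})
          \<le> prob {\<omega> \<in> space M. norm (\<Sum>i\<in>insert 1 {2..n}. Y i \<omega>) > n * a}"
        unfolding ins[symmetric]
        by (rule prob_one_big_jump) (auto intro: indep_vars_subset[OF indep])
      finally show ?case by (simp only: ins)
    qed
qed
qed

end

section \<open>Lower bounds for the surface measure\<close>

lemma emeasure_lborel_cbox_cart: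
  fixes l u :: "real ^ 'n"
  assumes "\<And>i. l $ i \<le> u $ i"
  shows "emeasure lborel (cbox l u) = ennreal (\<Prod>i\<in>UNIV. u $ i - l $ i)"
proof -
  have Basis: "(Basis :: (real ^ 'n) set) = range (\<lambda>i. axis i 1)"
    by (auto simp: Basis_vec_def)
  have "(\<Prod>b\<in>Basis. (u - l) \<bullet> b) = (\<Prod>i\<in>UNIV. u $ i - l $ i)"
    unfolding Basis by (subst prod.reindex) (auto simp: inj_on_def axis_eq_axis inner_axis)
  then show ?thesis
    using assms by (subst emeasure_lborel_cbox) (auto simp: Basis inner_axis)
qed

text \<open>Thickening the projection of the covering sets by the unit interval in direction \<open>k\<close> turns
  the \<open>(d - 1)\<close>-dimensional estimate into one about Lebesgue measure on \<open>\<real>\<^sup>d\<close>.\<close>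

lemma surface_measure_pos_if_projection:
  fixes S :: "(real ^ 'd) set" and k :: 'd
  assumes r: "0 < r"
    and proj: "\<And>y. \<forall>i. \<bar>y $ i\<bar> \<le> r \<Longrightarrow> \<exists>x\<in>S. \<forall>i. i \<noteq> k \<longrightarrow> x $ i = y $ i"
  shows "0 < surface_measure S"
proof -
  define N where "N = CARD('d) - 1"
  \<comment> \<open>The cube of half-side \<open>r\<close> in the coordinates other than
    \<open>k\<close>, times the unit interval, so that its volume is the volume of the projected
    cube.\<close>
  define D where "D = cbox ((\<chi> i. if i = k then 0 else - r) :: real ^ 'd) (\<chi> i. if i = k then 1 else r)"
  have prod_eq: "(\<Prod>i\<in>UNIV. if i = k then 1 else v) = v ^ N" for v :: real
    by (subst prod.If_cases) (auto simp: N_def Compl_eq_Diff_UNIV card_Diff_singleton)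
  have D: "emeasure lborel D = ennreal ((2 * r) ^ N)"
    unfolding D_def using r
    by (subst emeasure_lborel_cbox_cart) (auto simp: prod_eq[symmetric] intro!: arg_cong[of _ _ ennreal] prod.cong)
  define v where "v = unit_ball_vol (real N)"
  have v: "0 < v" by (simp add: v_def)
  \<comment> \<open>A covering set of diameter \<open>d\<close> will be enclosed in a box of side
    \<open>2 * d\<close> in every direction but \<open>k\<close>. Its volume is \<open>4 ^ N\<close>
    times \<open>(d / 2) ^ N\<close>, whence the factor \<open>1 / 4 ^ N\<close>; \<open>v\<close>
    is the normalisation in the premeasure.\<close>
  define c where "c = ennreal (v / 4 ^ N) * ennreal ((2 * r) ^ N)"
  \<comment> \<open>Covers of mesh 1 suffice, the Hausdorff measure being a supremum over all
    meshes.\<close>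
  have "c \<le> hausdorff_premeasure N 1 S"
    unfolding hausdorff_premeasure_def
  proof (rule INF_greatest, elim CollectE conjE)
    fix U :: "nat \<Rightarrow> (real ^ 'd) set"
    assume cover: "S \<subseteq> (\<Union>i. U i)" and U: "\<forall>i. bounded (U i) \<and> diameter (U i) \<le> 1"
    define p where "p i = (SOME x. x \<in> U i)" for i
    have p: "p i \<in> U i" if "U i \<noteq> {}" for i
      using that by (simp add: p_def some_in_eq)
    \<comment> \<open>The thickened projection of \<open>U i\<close> lies in this box around a
      chosen point of \<open>U i\<close>. Empty sets get an empty box, in agreement with their zero
      weight in the premeasure.\<close>
    define B where "B i = (if U i = {} then {} else
      cbox ((\<chi> j. if j = k then 0 else p i $ j - diameter (U i)) :: real ^ 'd)
        (\<chi> j. if j = k then 1 else p i $ j + diameter (U i)))" for i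
    have diam: "0 \<le> diameter (U i)" for i using U by (auto intro: diameter_ge_0)
    have B: "ennreal (v / 4 ^ N) * emeasure lborel (B i) =
        (if U i = {} then 0 else ennreal (v * (diameter (U i) / 2) ^ N))" for i
    proof (cases "U i = {}")
      case False
      have "emeasure lborel (B i) = ennreal ((2 * diameter (U i)) ^ N)"
        using False diam[of i] unfolding B_def
        by (subst if_not_P, simp, subst emeasure_lborel_cbox_cart)
          (auto simp: prod_eq[symmetric] intro!: arg_cong[of _ _ ennreal] prod.cong split: if_split_asm)
      also have "ennreal (v / 4 ^ N) * \<dots> = ennreal (v / 4 ^ N * (2 * diameter (U i)) ^ N)"
        by (rule ennreal_mult[symmetric]) (use v diam[of i] in auto)
      also have "v / 4 ^ N * (2 * diameter (U i)) ^ N = v * (2 * diameter (U i) / 4) ^ N"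
        by (simp only: power_divide times_divide_eq_left times_divide_eq_right)
      finally show ?thesis using False by simp
    qed (simp add: B_def)
    have "D \<subseteq> (\<Union>i. B i)"
    proof
      fix z assume z: "z \<in> D"
      \<comment> \<open>The coordinate \<open>z $ k\<close> ranges over the unit interval and may
        exceed \<open>r\<close>, so it is reset to 0 before \<open>proj\<close> is applied.\<close>
      then have "\<forall>i. \<bar>(\<chi> i. if i = k then 0 else z $ i) $ i\<bar> \<le> r"
        using r by (auto simp: D_def mem_box_cart abs_le_iff minus_le_iff split: if_splits)
      then obtain x where x: "x \<in> S" "\<forall>i. i \<noteq> k \<longrightarrow> x $ i = z $ i"
        using proj by fastforce
      then obtain i where i: "x \<in> U i" using cover by auto
      have comp: "\<bar>x $ j - p i $ j\<bar> \<le> diameter (U i)" for j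
      proof -
        have "\<bar>x $ j - p i $ j\<bar> \<le> norm (x - p i)"
          using component_le_norm_cart[of "x - p i" j] by simp
        also have "\<dots> \<le> diameter (U i)"
          using diameter_bounded_bound[of "U i" x "p i"] U i p[of i] by (auto simp: dist_norm)
        finally show ?thesis .
      qed
      have "p i $ j - diameter (U i) \<le> z $ j \<and> z $ j \<le> p i $ j + diameter (U i)" if "j \<noteq> k" for j
        using comp[of j] x(2)[rule_format, OF that] by (auto simp: abs_le_iff)
      then have "z \<in> B i"
        using z i by (auto simp: B_def D_def mem_box_cart split: if_splits)
      then show "z \<in> (\<Union>i. B i)" by auto
    qed
    then have "emeasure lborel D \<le> emeasure lborel (\<Union>i. B i)"
      by (intro emeasure_mono) (auto simp: B_def)
    also have "\<dots> \<le> (\<Sum>i. emeasure lborel (B i))"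
      by (intro emeasure_subadditive_countably) (auto simp: B_def)
    finally have "c \<le> ennreal (v / 4 ^ N) * (\<Sum>i. emeasure lborel (B i))"
      unfolding c_def D[symmetric] by (rule mult_left_mono) simp
    also have "\<dots> = (\<Sum>i. ennreal (v / 4 ^ N) * emeasure lborel (B i))"
      by (rule ennreal_suminf_cmult[symmetric])
    also have "\<dots> = (\<Sum>i. if U i = {} then 0 else ennreal (v * (diameter (U i) / 2) ^ N))"
      by (simp only: B)
    finally show "c \<le> (\<Sum>i. if U i = {} then 0
        else ennreal (unit_ball_vol (real N) * (diameter (U i) / 2) ^ N))"
      by (simp only: v_def)
  qed
  also have "\<dots> \<le> surface_measure S"
    unfolding surface_measure_def hausdorff_measure_def N_def[symmetric]
    by (rule SUP_upper) simp
  finally have "c \<le> surface_measure S" .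
  moreover have "0 < c"
    using v r by (simp add: c_def ennreal_zero_less_mult_iff)
  ultimately show ?thesis by (rule less_le_trans[rotated])
qed

section \<open>Diagonal matrices, ellipsoids and their caps\<close>

lemma diagonal_matrix_mult_vec:
  fixes A :: "real ^ 'd ^ 'd"
  assumes "diagonal_matrix A"
  shows "(A *v x) $ i = A $ i $ i * x $ i"
proof -
  have "(\<Sum>j\<in>UNIV. A $ i $ j * x $ j) = (\<Sum>j\<in>UNIV. if j = i then A $ i $ i * x $ i else 0)"
    using assms by (intro sum.cong) (auto simp: diagonal_matrix_def)
  then show ?thesis by (simp add: matrix_vector_mult_def)
qed

lemma matrix_inv_diagonal:
  fixes A :: "real ^ 'd ^ 'd"
  assumes A: "diagonal_matrix A" "\<And>i. A $ i $ i \<noteq> 0"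
  shows "matrix_inv A = (\<chi> i j. if i = j then 1 / A $ i $ i else 0)" (is "_ = ?D")
proof -
  have D: "diagonal_matrix ?D" by (simp add: diagonal_matrix_def)
  have AD: "A ** ?D = mat 1"
    unfolding matrix_eq matrix_vector_mul_assoc[symmetric]
    using A D by (simp add: vec_eq_iff diagonal_matrix_mult_vec)
  have DA: "?D ** A = mat 1"
    unfolding matrix_eq matrix_vector_mul_assoc[symmetric]
    using A D by (simp add: vec_eq_iff diagonal_matrix_mult_vec)
  \<comment> \<open>\<open>matrix_inv\<close> is a choice among two-sided inverses;
    \<open>?D\<close> witnesses that one exists, and uniqueness of inverses then identifies the
    chosen one.\<close>
  have "A ** matrix_inv A = mat 1 \<and> matrix_inv A ** A = mat 1"
    unfolding matrix_inv_def by (rule someI[of _ ?D]) (use AD DA in blast)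
  then have inv: "matrix_inv A ** A = mat 1" by blast
  from AD have "matrix_inv A = (matrix_inv A ** A) ** ?D"
    by (simp add: matrix_mul_assoc[symmetric])
  also have "\<dots> = ?D"
    by (simp add: inv)
  finally show ?thesis .
qed

lemma ellipsoid_borel: "ellipsoid A \<in> sets borel"
  unfolding ellipsoid_def
  by (intro borel_compact compact_continuous_image linear_continuous_on
      matrix_vector_mul_bounded_linear compact_sphere)

lemma norm_ellipsoid_le:
  fixes A :: "real ^ 'd ^ 'd"
  assumes A: "diagonal_matrix A" "\<And>i. 0 < A $ i $ i" "\<And>i. A $ i $ i \<le> \<alpha>"
    and x: "x \<in> ellipsoid A"
  shows "norm x \<le> \<alpha>"
proof -
  obtain u where u: "norm u = 1" "x = A *v u" using x by (auto simp: ellipsoid_def)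
  have \<alpha>: "0 \<le> \<alpha>" using A(2,3) by (meson less_imp_le order_trans)
  have "norm x \<le> norm (\<alpha> *\<^sub>R u)"
  proof (rule norm_le_componentwise_cart)
    fix i
    have "\<bar>A $ i $ i\<bar> * \<bar>u $ i\<bar> \<le> \<bar>\<alpha>\<bar> * \<bar>u $ i\<bar>"
      using A(2,3)[of i] by (intro mult_right_mono) auto
    then show "norm (x $ i) \<le> norm ((\<alpha> *\<^sub>R u) $ i)"
      by (simp add: u diagonal_matrix_mult_vec[OF A(1)] abs_mult)
  qed
  then show ?thesis using u \<alpha> by simp
qed

text \<open>Near the tip of axis \<open>k\<close> the ellipsoid is a graph over the other
  coordinates, so the cap projects onto a full cube and the projection criterion applies.\<close>

lemma surface_measure_cap_pos:
  fixes A :: "real ^ 'd ^ 'd"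
  assumes A: "diagonal_matrix A" "\<And>i. 0 < A $ i $ i" and \<epsilon>: "0 < \<epsilon>"
  shows "0 < surface_measure {x \<in> ellipsoid A. x $ k > A $ k $ k - \<epsilon>}"
proof -
  \<comment> \<open>If all coordinates of \<open>y\<close> are at most \<open>r\<close> in modulus,
    the rescaled squares sum to at most \<open>r\<^sup>2 * W = w\<close>. The bound
    \<open>w \<le> 1\<close> makes the remaining coordinate real, and
    \<open>\<epsilon> / (2 * A $ k $ k)\<close> keeps the lost height \<open>A $ k $ k * w\<close>
    below \<open>\<epsilon>\<close>.\<close>
  define W where "W = (\<Sum>i\<in>UNIV. 1 / (A $ i $ i)\<^sup>2)"
  define w where "w = min 1 (\<epsilon> / (2 * A $ k $ k))"
  define r where "r = sqrt (w / W)"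
  have W: "0 < W" unfolding W_def using A(2) by (intro sum_pos) (auto simp: less_imp_neq[symmetric])
  have w: "0 < w" "w \<le> 1" using A(2)[of k] \<epsilon> by (auto simp: w_def)
  have wk: "A $ k $ k * w < \<epsilon>"
  proof -
    have "A $ k $ k * w \<le> A $ k $ k * (\<epsilon> / (2 * A $ k $ k))"
      using A(2)[of k] by (intro mult_left_mono) (auto simp: w_def)
    also have "\<dots> < \<epsilon>" using A(2)[of k] \<epsilon> by (simp add: field_simps)
    finally show ?thesis .
  qed
  have r: "0 < r" "r\<^sup>2 = w / W" using W w by (auto simp: r_def)
  show ?thesis
  proof (rule surface_measure_pos_if_projection[where k = k, OF r(1)])
    fix y :: "real ^ 'd" assume y: "\<forall>i. \<bar>y $ i\<bar> \<le> r"
    define q where "q = (\<Sum>i\<in>UNIV - {k}. (y $ i / A $ i $ i)\<^sup>2)"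
    define u where "u = (\<chi> i. if i = k then sqrt (1 - q) else y $ i / A $ i $ i)"
    have q0: "0 \<le> q" by (auto simp: q_def intro: sum_nonneg)
    have "q \<le> (\<Sum>i\<in>UNIV. (y $ i / A $ i $ i)\<^sup>2)"
      unfolding q_def by (rule sum_mono2) auto
    also have "\<dots> \<le> (\<Sum>i\<in>UNIV. r\<^sup>2 * (1 / (A $ i $ i)\<^sup>2))"
    proof (rule sum_mono)
      fix i :: 'd
      have "(y $ i)\<^sup>2 \<le> r\<^sup>2" using y r(1) by (simp add: abs_le_square_iff[symmetric])
      then have "(y $ i)\<^sup>2 / (A $ i $ i)\<^sup>2 \<le> r\<^sup>2 / (A $ i $ i)\<^sup>2"
        by (rule divide_right_mono) simp
      then show "(y $ i / A $ i $ i)\<^sup>2 \<le> r\<^sup>2 * (1 / (A $ i $ i)\<^sup>2)"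
        by (simp add: power_divide)
    qed
    also have "\<dots> = r\<^sup>2 * W"
      unfolding W_def by (rule sum_distrib_left[symmetric])
    also have "\<dots> = w" using W by (simp add: r(2))
    finally have qw: "q \<le> w" .
    have "u \<bullet> u = (\<Sum>i\<in>UNIV. (u $ i)\<^sup>2)"
      by (simp add: inner_vec_def power2_eq_square)
    also have "\<dots> = (u $ k)\<^sup>2 + (\<Sum>i\<in>UNIV - {k}. (u $ i)\<^sup>2)"
      by (simp add: sum.remove[of UNIV k])
    also have "(\<Sum>i\<in>UNIV - {k}. (u $ i)\<^sup>2) = q"
      unfolding q_def by (intro sum.cong) (auto simp: u_def)
    also have "(u $ k)\<^sup>2 = 1 - q" using qw w by (simp add: u_def)
    finally have "norm u = 1" by (simp add: norm_eq_1)
    then have "A *v u \<in> ellipsoid A" by (simp add: ellipsoid_def)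
    moreover have "(A *v u) $ k > A $ k $ k - \<epsilon>"
    proof -
      \<comment> \<open>On the unit interval the square root dominates the identity, so the height
        loss is linear in \<open>q\<close>.\<close>
      have "1 - q \<le> sqrt (1 - q)"
      proof (rule real_le_rsqrt)
        have "(1 - q) * (1 - q) \<le> (1 - q) * 1" using q0 qw w by (intro mult_left_mono) auto
        then show "(1 - q)\<^sup>2 \<le> 1 - q" by (simp add: power2_eq_square)
      qed
      then have "A $ k $ k * (1 - w) \<le> A $ k $ k * sqrt (1 - q)"
        using A(2)[of k] qw by (intro mult_left_mono) auto
      with wk show ?thesis
        by (simp add: diagonal_matrix_mult_vec[OF A(1)] u_def algebra_simps)
    qed
    moreover have "(A *v u) $ i = y $ i" if "i \<noteq> k" for i
      using that A(2)[of i] by (simp add: diagonal_matrix_mult_vec[OF A(1)] u_def)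
    ultimately show "\<exists>x\<in>{x \<in> ellipsoid A. x $ k > A $ k $ k - \<epsilon>}. \<forall>i. i \<noteq> k \<longrightarrow> x $ i = y $ i"
      by blast
  qed
qed

section \<open>Moments and tails from the Weibull radius\<close>

text \<open>An arbitrarily small share \<open>\<delta>\<close> of the exponent absorbs the square.
  It is \<open>y \<le> exp y\<close> raised to the power \<open>2 / \<beta>\<close>, with
  \<open>y\<close> scaled so that \<open>exp y\<close> becomes exactly
  \<open>exp (\<delta> * r powr \<beta>)\<close>.\<close>

lemma square_le_exp_powr:
  fixes r \<beta> \<delta> :: real
  assumes "0 < \<beta>" "0 < \<delta>" "0 \<le> r"
  shows "r\<^sup>2 \<le> (2 / (\<delta> * \<beta>)) powr (2 / \<beta>) * exp (\<delta> * r powr \<beta>)"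
proof (cases "r = 0")
  case False
  define y where "y = \<delta> * \<beta> / 2 * r powr \<beta>"
  have y: "0 \<le> y" using assms by (simp add: y_def)
  have "r\<^sup>2 = r powr (\<beta> * (2 / \<beta>))"
    using assms False by simp
  also have "\<dots> = (2 / (\<delta> * \<beta>) * y) powr (2 / \<beta>)"
    using assms by (simp add: y_def powr_powr)
  also have "\<dots> = (2 / (\<delta> * \<beta>)) powr (2 / \<beta>) * y powr (2 / \<beta>)"
    using assms y by (intro powr_mult)
  also have "y powr (2 / \<beta>) \<le> exp y powr (2 / \<beta>)"
  proof (rule powr_mono2)
    show "y \<le> exp y" using exp_ge_add_one_self[of y] by linarith
  qed (use assms y in auto)
  also have "exp y powr (2 / \<beta>) = exp (\<delta> * r powr \<beta>)"
    using assms by (simp add: exp_powr_real y_def)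
  finally show ?thesis by (simp add: mult_left_mono)
qed simp

context prob_space
begin

text \<open>Reduces moments of the radius to integrals of an exponential density. The absolute value
  avoids powers of negative bases on the null set where \<open>R\<close> is negative.\<close>

lemma weibull_powr_exponential:
  assumes W: "weibull M \<kappa> \<beta> R" and "0 < \<kappa>" "0 < \<beta>"
  shows "distributed M lborel (\<lambda>\<omega>. \<bar>R \<omega>\<bar> powr \<beta>) (exponential_density \<kappa>)"
proof (subst exponential_distributed_iff[OF \<open>0 < \<kappa>\<close>], intro conjI allI impI)
  have [measurable]: "R \<in> borel_measurable M" and R: "AE \<omega> in M. R \<omega> \<ge> 0"
    using W by (auto simp: weibull_def)
  show "(\<lambda>\<omega>. \<bar>R \<omega>\<bar> powr \<beta>) \<in> borel_measurable M" by measurable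
  fix v :: real assume v: "0 \<le> v"
  have inv: "(v powr (1 / \<beta>)) powr \<beta> = v"
    using v assms by (simp add: powr_powr)
  have iff: "r powr \<beta> \<le> v \<longleftrightarrow> \<not> r > v powr (1 / \<beta>)" if "0 \<le> r" for r
    using that powr_mono2[of \<beta> r "v powr (1 / \<beta>)"] powr_less_mono2[of \<beta> "v powr (1 / \<beta>)" r] assms
    unfolding inv by (auto simp: not_less) fastforce
  have "prob {\<omega> \<in> space M. \<bar>R \<omega>\<bar> powr \<beta> \<le> v} = prob {\<omega> \<in> space M. \<not> R \<omega> > v powr (1 / \<beta>)}"
    using R by (intro finite_measure_eq_AE) (auto elim!: eventually_mono simp: iff)
  also have "\<dots> = 1 - prob {\<omega> \<in> space M. R \<omega> > v powr (1 / \<beta>)}"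
    by (rule prob_neg) measurable
  also have "prob {\<omega> \<in> space M. R \<omega> > v powr (1 / \<beta>)} = exp (- v * \<kappa>)"
    using W by (simp add: weibull_def weibull_h_def inv mult.commute)
  finally show "prob {\<omega> \<in> space M. \<bar>R \<omega>\<bar> powr \<beta> \<le> v} = 1 - exp (- v * \<kappa>)" .
qed

text \<open>Tilting the exponential density of rate \<open>\<kappa>\<close> by
  \<open>exp (s * x)\<close> gives \<open>\<kappa> / (\<kappa> - s)\<close> times the density of
  rate \<open>\<kappa> - s\<close>, which has mass 1.\<close>

lemma weibull_exp_moment:
  assumes W: "weibull M \<kappa> \<beta> R" and "0 < \<kappa>" "0 < \<beta>" "s < \<kappa>"
  shows "integrable M (\<lambda>\<omega>. exp (s * \<bar>R \<omega>\<bar> powr \<beta>))"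
proof -
  let ?f = "exponential_density (\<kappa> - s)"
  interpret E: prob_space "density lborel ?f"
    using assms by (intro prob_space_exponential_density) simp
  have "integrable (density lborel ?f) (\<lambda>_. 1 :: real)" by simp
  then have "integrable lborel ?f"
    by (subst (asm) integrable_real_density) (use assms in \<open>auto simp: exponential_density_def[abs_def]\<close>)
  then have "integrable lborel (\<lambda>x. \<kappa> / (\<kappa> - s) * ?f x)" by simp
  also have "(\<lambda>x. \<kappa> / (\<kappa> - s) * ?f x) = (\<lambda>x. exponential_density \<kappa> x * exp (s * x))"
  proof
    fix x
    have "exp (- x * (\<kappa> - s)) = exp (- x * \<kappa>) * exp (s * x)"
      by (simp add: algebra_simps flip: exp_add)
    then show "\<kappa> / (\<kappa> - s) * ?f x = exponential_density \<kappa> x * exp (s * x)"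
      unfolding exponential_density_def using assms by simp
  qed
  finally show ?thesis
    by (subst (asm) distributed_integrable[OF weibull_powr_exponential[OF assms(1-3)]])
      (use assms in \<open>auto simp: exponential_density_def\<close>)
qed

text \<open>Domination turns \<open>\<mu>\<close> into the exponent
  \<open>\<mu> * \<alpha> powr \<beta>\<close> for the radius, still below \<open>\<kappa>\<close>.
  Half of the remaining gap absorbs the square, the other half keeps the exponential moment
  finite.\<close>

lemma weibull_dominated_moment:
  fixes Y :: "'a \<Rightarrow> 'b::euclidean_space"
  assumes W: "weibull M \<kappa> \<beta> R" and "0 < \<kappa>" "0 < \<beta>" "0 < \<alpha>"
    and [measurable]: "Y \<in> borel_measurable M" and Y: "AE \<omega> in M. norm (Y \<omega>) \<le> \<alpha> * \<bar>R \<omega>\<bar>"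
    and \<mu>: "0 < \<mu>" "\<mu> < \<kappa> / \<alpha> powr \<beta>"
  shows "integrable M (\<lambda>\<omega>. (norm (Y \<omega>))\<^sup>2 * exp (\<mu> * norm (Y \<omega>) powr \<beta>))"
proof -
  define \<mu>' where "\<mu>' = \<mu> * \<alpha> powr \<beta>"
  define \<delta> where "\<delta> = (\<kappa> - \<mu>') / 2"
  define C where "C = (2 / (\<delta> * \<beta>)) powr (2 / \<beta>)"
  have "\<mu>' < \<kappa>" using \<mu> assms by (simp add: \<mu>'_def field_simps)
  then have \<delta>: "0 < \<delta>" "\<delta> + \<mu>' < \<kappa>" by (auto simp: \<delta>_def field_simps)
  have "integrable M (\<lambda>\<omega>. \<alpha>\<^sup>2 * C * exp ((\<delta> + \<mu>') * \<bar>R \<omega>\<bar> powr \<beta>))"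
    using weibull_exp_moment[OF W \<open>0 < \<kappa>\<close> \<open>0 < \<beta>\<close> \<delta>(2)] by simp
  then show ?thesis
  proof (rule Bochner_Integration.integrable_bound)
    show "AE \<omega> in M. norm ((norm (Y \<omega>))\<^sup>2 * exp (\<mu> * norm (Y \<omega>) powr \<beta>))
        \<le> norm (\<alpha>\<^sup>2 * C * exp ((\<delta> + \<mu>') * \<bar>R \<omega>\<bar> powr \<beta>))"
      using Y
    proof eventually_elim
      case (elim \<omega>)
      let ?r = "\<bar>R \<omega>\<bar>"
      have "(norm (Y \<omega>))\<^sup>2 \<le> (\<alpha> * ?r)\<^sup>2"
        using elim by (intro power_mono) auto
      also have "\<dots> \<le> \<alpha>\<^sup>2 * (C * exp (\<delta> * ?r powr \<beta>))"
        unfolding power_mult_distrib C_def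
        using \<delta> assms by (intro mult_left_mono square_le_exp_powr) auto
      finally have 1: "(norm (Y \<omega>))\<^sup>2 \<le> \<alpha>\<^sup>2 * (C * exp (\<delta> * ?r powr \<beta>))" .
      have "norm (Y \<omega>) powr \<beta> \<le> (\<alpha> * ?r) powr \<beta>"
        using elim assms by (intro powr_mono2) auto
      then have "\<mu> * norm (Y \<omega>) powr \<beta> \<le> \<mu>' * ?r powr \<beta>"
        using \<mu> assms by (simp add: \<mu>'_def powr_mult)
      then have 2: "exp (\<mu> * norm (Y \<omega>) powr \<beta>) \<le> exp (\<mu>' * ?r powr \<beta>)" by simp
      have "(norm (Y \<omega>))\<^sup>2 * exp (\<mu> * norm (Y \<omega>) powr \<beta>)
          \<le> \<alpha>\<^sup>2 * (C * exp (\<delta> * ?r powr \<beta>)) * exp (\<mu>' * ?r powr \<beta>)"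
        using 1 2 by (intro mult_mono) (auto simp: C_def)
      also have "\<dots> = \<alpha>\<^sup>2 * C * exp ((\<delta> + \<mu>') * ?r powr \<beta>)"
        by (simp add: distrib_right exp_add)
      finally show ?case by (simp add: C_def)
    qed
  qed measurable
qed

text \<open>A large radius together with a direction in the cap at the tip of axis \<open>k\<close>
  forces a large norm. By (A2') the cap keeps a positive conditional probability, a constant factor
  invisible at the exponential scale.\<close>

lemma weibull_ellipsoid_tail:
  fixes A :: "real ^ 'd ^ 'd"
  assumes W: "weibull M \<kappa> \<beta> R" and "0 < \<kappa>" "0 < \<beta>"
    and A: "diagonal_matrix A" "\<And>i. 0 < A $ i $ i"
    and A2: "assumption_A2' M (ellipsoid A) R \<Theta>"
    and \<nu>: "\<kappa> / (A $ k $ k) powr \<beta> < \<nu>"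
  shows "eventually (\<lambda>x. exp (- \<nu> * x powr \<beta>)
    \<le> prob {\<omega> \<in> space M. norm (R \<omega> *\<^sub>R \<Theta> \<omega>) > x}) at_top"
proof -
  define \<alpha> where "\<alpha> = A $ k $ k"
  have \<alpha>: "0 < \<alpha>" using A by (simp add: \<alpha>_def)
  have [measurable]: "R \<in> borel_measurable M" "\<Theta> \<in> borel_measurable M"
    using W A2 by (auto simp: weibull_def assumption_A2'_def)
  \<comment> \<open>A thin cap has height close to \<open>\<alpha>\<close>, so the rate obtained
    from it stays below \<open>\<nu>\<close>.\<close>
  have "((\<lambda>\<epsilon>. \<kappa> / (\<alpha> - \<epsilon>) powr \<beta>) \<longlongrightarrow> \<kappa> / (\<alpha> - 0) powr \<beta>) (at_right 0)"
    using \<alpha> by (intro tendsto_intros) auto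
  then have "eventually (\<lambda>\<epsilon>. \<kappa> / (\<alpha> - \<epsilon>) powr \<beta> < \<nu>) (at_right 0)"
    by (rule order_tendstoD) (use \<nu> in \<open>simp add: \<alpha>_def\<close>)
  moreover have "eventually (\<lambda>\<epsilon>. \<epsilon> \<in> {0<..<\<alpha>}) (at_right 0)"
    using \<alpha> by (rule eventually_at_right_real)
  ultimately have "eventually (\<lambda>\<epsilon>. \<kappa> / (\<alpha> - \<epsilon>) powr \<beta> < \<nu> \<and> \<epsilon> \<in> {0<..<\<alpha>}) (at_right 0)"
    by (rule eventually_conj)
  from eventually_happens'[OF trivial_limit_at_right_real this]
  obtain \<epsilon> where \<epsilon>: "0 < \<epsilon>" "\<epsilon> < \<alpha>" "\<kappa> / (\<alpha> - \<epsilon>) powr \<beta> < \<nu>" by auto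
  define S where "S = {x \<in> ellipsoid A. x $ k > \<alpha> - \<epsilon>}"
  have halfspace: "{x :: real ^ 'd. x $ k > \<alpha> - \<epsilon>} \<in> sets borel"
    by (intro borel_open open_Collect_less continuous_intros)
  have S [measurable]: "S \<in> sets borel"
    using sets.Int[OF ellipsoid_borel[of A] halfspace] by (simp add: S_def Int_def)
  define p where "p = prob {\<omega> \<in> space M. \<Theta> \<omega> \<in> S}"
  have "S \<subseteq> ellipsoid A" "0 < surface_measure S"
    unfolding S_def \<alpha>_def using surface_measure_cap_pos[OF A \<epsilon>(1), of k] by auto
  with A2 S have p: "0 < p"
    and cond: "((\<lambda>x. \<P>(\<omega> in M. \<Theta> \<omega> \<in> S \<bar> R \<omega> > x)) \<longlongrightarrow> p) at_top"
    by (auto simp: assumption_A2'_def p_def)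
  from cond have "eventually (\<lambda>x. p / 2 < \<P>(\<omega> in M. \<Theta> \<omega> \<in> S \<bar> R \<omega> > x)) at_top"
    by (rule order_tendstoD) (use p in simp)
  moreover have "filterlim (\<lambda>x. x * (1 / (\<alpha> - \<epsilon>))) at_top at_top"
    using \<epsilon> by (intro filterlim_at_top_mult_tendsto_pos[OF tendsto_const _ filterlim_ident]) simp
  ultimately have cond': "eventually (\<lambda>x. p / 2 < \<P>(\<omega> in M. \<Theta> \<omega> \<in> S \<bar> R \<omega> > x * (1 / (\<alpha> - \<epsilon>)))) at_top"
    by (rule eventually_compose_filterlim)
  \<comment> \<open>The slack left in the rate; it makes \<open>exp (- e * x powr \<beta>)\<close>
    fall below the constant \<open>p / 2\<close>.\<close>
  define e where "e = \<nu> - \<kappa> / (\<alpha> - \<epsilon>) powr \<beta>"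
  have "0 < e" using \<epsilon> by (simp add: e_def)
  then have "((\<lambda>x. exp (- e * x powr \<beta>)) \<longlongrightarrow> 0) at_top"
    using \<open>0 < \<beta>\<close> by real_asymp
  then have "eventually (\<lambda>x. exp (- e * x powr \<beta>) < p / 2) at_top"
    by (rule order_tendstoD) (use p in simp)
  with cond' eventually_ge_at_top[of 0] show ?thesis
  proof eventually_elim
    case (elim x)
    \<comment> \<open>Beyond this radius every direction in the cap carries the \<open>k\<close>-th
      coordinate past \<open>x\<close>.\<close>
    define y where "y = x * (1 / (\<alpha> - \<epsilon>))"
    have y: "0 \<le> y" using elim \<epsilon> by (simp add: y_def)
    have PR: "prob {\<omega> \<in> space M. R \<omega> > y} = exp (- \<kappa> * y powr \<beta>)"
      using W y by (simp add: weibull_def weibull_h_def)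
    have "exp (- \<nu> * x powr \<beta>) = exp (- e * x powr \<beta>) * exp (- \<kappa> * y powr \<beta>)"
      using elim \<epsilon> unfolding exp_add[symmetric]
      by (simp add: e_def y_def powr_divide algebra_simps)
    also have "\<dots> \<le> \<P>(\<omega> in M. \<Theta> \<omega> \<in> S \<bar> R \<omega> > y) * prob {\<omega> \<in> space M. R \<omega> > y}"
      unfolding PR using elim by (intro mult_right_mono) (auto simp: y_def)
    also have "\<dots> = prob {\<omega> \<in> space M. \<Theta> \<omega> \<in> S \<and> R \<omega> > y}"
      by (simp add: cond_prob_def PR)
    also have "\<dots> \<le> prob {\<omega> \<in> space M. norm (R \<omega> *\<^sub>R \<Theta> \<omega>) > x}"
    proof (intro finite_measure_mono subsetI)
      fix \<omega> assume "\<omega> \<in> {\<omega> \<in> space M. \<Theta> \<omega> \<in> S \<and> R \<omega> > y}"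
      then have \<omega>: "\<omega> \<in> space M" "\<Theta> \<omega> $ k > \<alpha> - \<epsilon>" "R \<omega> > y" by (auto simp: S_def)
      have "x = y * (\<alpha> - \<epsilon>)" using \<epsilon> by (simp add: y_def)
      also have "\<dots> < R \<omega> * \<Theta> \<omega> $ k"
        using \<omega> y \<epsilon> by (intro mult_strict_mono') auto
      also have "\<dots> \<le> norm (R \<omega> *\<^sub>R \<Theta> \<omega>)"
        using component_le_norm_cart[of "R \<omega> *\<^sub>R \<Theta> \<omega>" k] by simp
      finally show "\<omega> \<in> {\<omega> \<in> space M. norm (R \<omega> *\<^sub>R \<Theta> \<omega>) > x}" using \<omega> by simp
    qed measurable
    finally show ?case .
  qed
qed

text \<open>The common form of both limits, with \<open>\<alpha>\<close> the largest stretching of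
  the radius. Dividing by \<open>\<kappa>\<close> passes from \<open>n powr \<beta>\<close> to the
  Weibull normalisation and cancels \<open>\<kappa>\<close> from the limit.\<close>

lemma weibull_random_walk_limit:
  fixes Y :: "nat \<Rightarrow> 'a \<Rightarrow> 'b::euclidean_space"
  assumes W: "weibull M \<kappa> \<beta> R" and pos: "0 < \<kappa>" "0 < \<beta>" "\<beta> < 1" "0 < \<alpha>" "0 < a"
    and indep: "indep_vars (\<lambda>_. borel) Y {1..}"
    and dist: "\<And>i. 1 \<le> i \<Longrightarrow> distr M borel (Y i) = distr M borel Y\<^sub>0"
    and int: "integrable M Y\<^sub>0" and mean: "expectation Y\<^sub>0 = 0"
    and Y\<^sub>0: "AE \<omega> in M. norm (Y\<^sub>0 \<omega>) \<le> \<alpha> * \<bar>R \<omega>\<bar>"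
    and tail: "\<And>\<nu>. \<kappa> / \<alpha> powr \<beta> < \<nu> \<Longrightarrow>
      eventually (\<lambda>x. exp (- \<nu> * x powr \<beta>) \<le> prob {\<omega> \<in> space M. norm (Y\<^sub>0 \<omega>) > x}) at_top"
  shows "(\<lambda>n. ln (prob {\<omega> \<in> space M. norm ((1 / real n) *\<^sub>R (\<Sum>i=1..n. Y i \<omega>)) > a})
    / weibull_h \<kappa> \<beta> (real n)) \<longlonglongrightarrow> - ((a / \<alpha>) powr \<beta>)"
proof -
  have [measurable]: "Y\<^sub>0 \<in> borel_measurable M" using int by auto
  have "(\<lambda>n. ln (prob {\<omega> \<in> space M. norm (\<Sum>i=1..n. Y i \<omega>) > n * a}) / n powr \<beta>)
      \<longlonglongrightarrow> - (\<kappa> / \<alpha> powr \<beta> * a powr \<beta>)"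
    using pos
    by (intro stretched_exponential_large_deviation[OF indep dist int mean _ tail]
        weibull_dominated_moment[OF W _ _ _ _ Y\<^sub>0]) auto
  then have "(\<lambda>n. ln (prob {\<omega> \<in> space M. norm (\<Sum>i=1..n. Y i \<omega>) > n * a}) / n powr \<beta> / \<kappa>)
      \<longlonglongrightarrow> - (\<kappa> / \<alpha> powr \<beta> * a powr \<beta>) / \<kappa>"
    by (intro tendsto_divide tendsto_const) (use pos in auto)
  also have "- (\<kappa> / \<alpha> powr \<beta> * a powr \<beta>) / \<kappa> = - ((a / \<alpha>) powr \<beta>)"
    using pos by (simp add: powr_divide)
  finally show ?thesis
  proof (rule Lim_transform_eventually)
    show "eventually (\<lambda>n. ln (prob {\<omega> \<in> space M. norm (\<Sum>i=1..n. Y i \<omega>) > n * a}) / n powr \<beta> / \<kappa>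
      = ln (prob {\<omega> \<in> space M. norm ((1 / real n) *\<^sub>R (\<Sum>i=1..n. Y i \<omega>)) > a})
    / weibull_h \<kappa> \<beta> (real n)) sequentially"
      using eventually_gt_at_top[of 0]
    proof eventually_elim
      case (elim n)
      \<comment> \<open>The rescaling is read off for \<open>n > 0\<close>, since
        \<open>1 / real 0\<close> is the default value 0.\<close>
      then have "norm ((1 / real n) *\<^sub>R s) > a \<longleftrightarrow> norm s > n * a" for s :: 'b
        by (simp add: field_simps)
      then show ?case by (simp add: weibull_h_def mult.commute)
    qed
  qed
qed

end

section \<open>Comparison of the rates with and without reinsurance\<close>

theorem theorem4p5:
  fixes M :: "'a measure"
    and R :: "'a \<Rightarrow> real"
    and \<Theta> :: "'a \<Rightarrow> real ^ 'd"
    and X :: "nat \<Rightarrow> 'a \<Rightarrow> real ^ 'd"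
    and S :: "nat \<Rightarrow> 'a \<Rightarrow> real ^ 'd"
    and A Q :: "real ^ 'd ^ 'd"
    and \<kappa> \<beta> a c :: real
  assumes "prob_space M"
    and "diagonal_matrix A" and "\<forall>k. A $ k $ k > 0"
    and "assumption_A2' M (ellipsoid A) R \<Theta>"
    and "\<kappa> > 0" and "0 < \<beta>" and "\<beta> < 1" and "weibull M \<kappa> \<beta> R"
    and "prob_space.indep_vars M (\<lambda>_. borel) X {1..}"
    and "\<forall>i\<ge>1. distr M borel (X i) = distr M borel (\<lambda>\<omega>. R \<omega> *\<^sub>R \<Theta> \<omega>)"
    and "\<forall>n \<omega>. S n \<omega> = (\<Sum>i=1..n. X i \<omega>)"
    and "a > 0" and "c > Max (range (\<lambda>j. 1 / A $ j $ j))"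
    and "Q = mat 1 - (1 / c) *\<^sub>R matrix_inv A"
  shows "quota_share Q \<and>
    (let L = (\<lambda>n. ln (\<P>(\<omega> in M. norm ((1 / real n) *\<^sub>R S n \<omega>) > a)) / weibull_h \<kappa> \<beta> (real n));
         L' = (\<lambda>n. ln (\<P>(\<omega> in M. norm ((mat 1 - Q) *v ((1 / real n) *\<^sub>R S n \<omega>)) > a))
                     / weibull_h \<kappa> \<beta> (real n))
     in convergent L \<and> convergent L' \<and> lim L > lim L')"
proof -
  interpret prob_space M by fact
  note A = \<open>diagonal_matrix A\<close> spec[OF \<open>\<forall>k. A $ k $ k > 0\<close>]
  note W = \<open>weibull M \<kappa> \<beta> R\<close> and A2 = \<open>assumption_A2' M (ellipsoid A) R \<Theta>\<close>
  note indep = \<open>indep_vars (\<lambda>_. borel) X {1..}\<close>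
  define Y where "Y = (\<lambda>\<omega>. R \<omega> *\<^sub>R \<Theta> \<omega>)"
  define B where "B = mat 1 - Q"
  have c: "1 / A $ j $ j < c" for j
    using \<open>c > Max _\<close> by (subst (asm) Max_less_iff) auto
  have c0: "0 < c" using c[of undefined] A(2)[of undefined] by (meson less_trans zero_less_divide_1_iff)
  have B: "diagonal_matrix B" "\<And>i. B $ i $ i = 1 / (c * A $ i $ i)"
    using A(2) by (auto simp: B_def \<open>Q = _\<close> matrix_inv_diagonal[OF A(1)] diagonal_matrix_def less_imp_neq[symmetric])
  have quota: "quota_share Q"
    unfolding quota_share_def
  proof (intro conjI allI)
    have Q: "Q = mat 1 - B" by (simp add: B_def)
    show "diagonal_matrix Q" using B(1) by (simp add: Q diagonal_matrix_def mat_def)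
    fix j
    \<comment> \<open>This puts the entry \<open>1 - 1 / (c * A $ j $ j)\<close> of \<open>Q\<close>
      strictly between 0 and 1.\<close>
    have "1 < c * A $ j $ j" using c[of j] A(2)[of j] by (simp add: field_simps)
    then show "0 < Q $ j $ j" "Q $ j $ j < 1"
      by (simp_all add: Q mat_def B(2) field_simps)
  qed
  obtain k where k: "\<And>i. A $ i $ i \<le> A $ k $ k"
  proof -
    have "Max (range (\<lambda>j. A $ j $ j)) \<in> range (\<lambda>j. A $ j $ j)" by (intro Max_in) auto
    then obtain k where "Max (range (\<lambda>j. A $ j $ j)) = A $ k $ k" by (rule rangeE)
    moreover have "A $ i $ i \<le> Max (range (\<lambda>j. A $ j $ j))" for i by (intro Max_ge) auto
    ultimately show ?thesis by (intro that[of k]) simp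
  qed
  define \<alpha> where "\<alpha> = A $ k $ k"
  have \<alpha>: "0 < \<alpha>" using A by (simp add: \<alpha>_def)
  have [measurable]: "R \<in> borel_measurable M" "\<Theta> \<in> borel_measurable M"
    and \<Theta>: "AE \<omega> in M. \<Theta> \<omega> \<in> ellipsoid A"
    and int: "integrable M Y" and mean: "expectation Y = 0"
    using W A2 by (auto simp: weibull_def assumption_A2'_def Y_def)
  have R: "AE \<omega> in M. R \<omega> \<ge> 0" using W by (simp add: weibull_def)
  have [measurable]: "Y \<in> borel_measurable M" using int by auto
  have dist: "distr M borel (X i) = distr M borel Y" if "1 \<le> i" for i
    using that assms(10) by (simp add: Y_def)
  have "(\<lambda>n. ln (prob {\<omega> \<in> space M. norm ((1 / real n) *\<^sub>R (\<Sum>i=1..n. X i \<omega>)) > a})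
    / weibull_h \<kappa> \<beta> (real n)) \<longlonglongrightarrow> - ((a / \<alpha>) powr \<beta>)"
  proof (rule weibull_random_walk_limit[OF W \<open>0 < \<kappa>\<close> \<open>0 < \<beta>\<close> \<open>\<beta> < 1\<close> \<alpha> \<open>0 < a\<close> indep dist int mean])
    show "AE \<omega> in M. norm (Y \<omega>) \<le> \<alpha> * \<bar>R \<omega>\<bar>"
      using \<Theta>
    proof eventually_elim
      case (elim \<omega>)
      have "norm (\<Theta> \<omega>) \<le> \<alpha>" using norm_ellipsoid_le[OF A k elim] by (simp add: \<alpha>_def)
      then have "norm (\<Theta> \<omega>) * \<bar>R \<omega>\<bar> \<le> \<alpha> * \<bar>R \<omega>\<bar>" by (rule mult_right_mono) simp
      then show ?case by (simp add: Y_def mult.commute)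
    qed
    show "eventually (\<lambda>x. exp (- \<nu> * x powr \<beta>) \<le> prob {\<omega> \<in> space M. norm (Y \<omega>) > x}) at_top"
      if "\<kappa> / \<alpha> powr \<beta> < \<nu>" for \<nu>
      unfolding Y_def using that \<alpha>_def
      by (intro weibull_ellipsoid_tail[OF W \<open>0 < \<kappa>\<close> \<open>0 < \<beta>\<close> A A2]) auto
  qed
  then have L: "(\<lambda>n. ln (\<P>(\<omega> in M. norm ((1 / real n) *\<^sub>R S n \<omega>) > a)) / weibull_h \<kappa> \<beta> (real n))
      \<longlonglongrightarrow> - ((a / \<alpha>) powr \<beta>)"
    by (simp add: assms(11))
  \<comment> \<open>\<open>B\<close> undoes \<open>A\<close> up to the factor \<open>1 / c\<close>,
    so the direction is mapped to a unit vector over \<open>c\<close> and only the radius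
    remains.\<close>
  have norm_BY: "AE \<omega> in M. norm (B *v Y \<omega>) = 1 / c * R \<omega>"
    using \<Theta> R
  proof eventually_elim
    case (elim \<omega>)
    then obtain u where u: "norm u = 1" "\<Theta> \<omega> = A *v u" by (auto simp: ellipsoid_def)
    have "B *v \<Theta> \<omega> = (1 / c) *\<^sub>R u"
      using A(2) c0 less_imp_neq[OF A(2), symmetric]
      by (simp add: vec_eq_iff u diagonal_matrix_mult_vec[OF A(1)] diagonal_matrix_mult_vec[OF B(1)] B(2))
    then show ?case using elim c0 u by (simp add: Y_def matrix_vector_mult_scaleR)
  qed
  have bl: "bounded_linear ((*v) B)" by simp
  have [measurable]: "(*v) B \<in> borel_measurable borel"
    by (intro borel_measurable_continuous_onI linear_continuous_on bl)
  have "(\<lambda>n. ln (prob {\<omega> \<in> space M. norm ((1 / real n) *\<^sub>R (\<Sum>i=1..n. B *v X i \<omega>)) > a})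
    / weibull_h \<kappa> \<beta> (real n)) \<longlonglongrightarrow> - ((a / (1 / c)) powr \<beta>)"
  proof (rule weibull_random_walk_limit[OF W \<open>0 < \<kappa>\<close> \<open>0 < \<beta>\<close> \<open>\<beta> < 1\<close> _ \<open>0 < a\<close>])
    show "indep_vars (\<lambda>_. borel) (\<lambda>i \<omega>. B *v X i \<omega>) {1..}"
      by (rule indep_vars_compose2[OF indep]) measurable
    show "distr M borel (\<lambda>\<omega>. B *v X i \<omega>) = distr M borel (\<lambda>\<omega>. B *v Y \<omega>)" if "1 \<le> i" for i
    proof -
      have [measurable]: "X i \<in> borel_measurable M"
        using indep that by (auto simp: indep_vars_def)
      show ?thesis
        using arg_cong[OF dist[OF that], of "\<lambda>N. distr N borel ((*v) B)"]
        by (simp add: distr_distr comp_def)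
    qed
    show "integrable M (\<lambda>\<omega>. B *v Y \<omega>)"
      using int by (rule integrable_bounded_linear[OF bl])
    show "expectation (\<lambda>\<omega>. B *v Y \<omega>) = 0"
      using integral_bounded_linear[OF bl int] mean by simp
    show "AE \<omega> in M. norm (B *v Y \<omega>) \<le> 1 / c * \<bar>R \<omega>\<bar>"
      using norm_BY R by eventually_elim simp
    show "0 < 1 / c" using c0 by simp
    \<comment> \<open>Since the norm is \<open>R / c\<close> almost everywhere, its tail at
      \<open>x\<close> is exactly the Weibull tail at \<open>c * x\<close>, with rate
      \<open>\<kappa> * c powr \<beta>\<close>.\<close>
    show "eventually (\<lambda>x. exp (- \<nu> * x powr \<beta>) \<le> prob {\<omega> \<in> space M. norm (B *v Y \<omega>) > x}) at_top"
      if \<nu>: "\<kappa> / (1 / c) powr \<beta> < \<nu>" for \<nu>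
      using eventually_ge_at_top[of 0]
    proof eventually_elim
      case (elim x)
      have "\<kappa> * c powr \<beta> \<le> \<nu>" using \<nu> c0 by (simp add: powr_divide)
      then have "\<kappa> * c powr \<beta> * x powr \<beta> \<le> \<nu> * x powr \<beta>" by (rule mult_right_mono) simp
      then have "exp (- \<nu> * x powr \<beta>) \<le> exp (- \<kappa> * (c * x) powr \<beta>)"
        using c0 elim by (simp add: powr_mult mult.assoc)
      also have "\<dots> = prob {\<omega> \<in> space M. R \<omega> > c * x}"
        using W elim c0 by (simp add: weibull_def weibull_h_def)
      also have "\<dots> = prob {\<omega> \<in> space M. norm (B *v Y \<omega>) > x}"
      proof (rule finite_measure_eq_AE)
        show "AE \<omega> in M. \<omega> \<in> {\<omega> \<in> space M. R \<omega> > c * x}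
            \<longleftrightarrow> \<omega> \<in> {\<omega> \<in> space M. norm (B *v Y \<omega>) > x}"
          using norm_BY by eventually_elim (use c0 in \<open>simp add: pos_less_divide_eq mult.commute\<close>)
      qed measurable
      finally show ?case .
    qed
  qed
  moreover have "(\<Sum>i=1..n. B *v X i \<omega>) = B *v S n \<omega>" for n \<omega>
    by (simp add: assms(11) linear_sum[OF matrix_vector_mul_linear])
  ultimately have L': "(\<lambda>n. ln (\<P>(\<omega> in M. norm ((mat 1 - Q) *v ((1 / real n) *\<^sub>R S n \<omega>)) > a))
      / weibull_h \<kappa> \<beta> (real n)) \<longlonglongrightarrow> - ((a * c) powr \<beta>)"
    unfolding B_def[symmetric] by (simp add: matrix_vector_mult_scaleR)
  \<comment> \<open>The bound on \<open>c\<close> at the longest semi-axis separates the rates; both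
    limits carry a minus sign, so the larger power belongs to the smaller limit.\<close>
  have "a / \<alpha> < a * c" using c[of k] \<open>a > 0\<close> \<alpha> by (simp add: \<alpha>_def field_simps)
  then have "(a / \<alpha>) powr \<beta> < (a * c) powr \<beta>"
    using \<open>a > 0\<close> \<alpha> \<open>0 < \<beta>\<close> by (intro powr_less_mono2) auto
  then show ?thesis
    using quota L L' by (auto simp: Let_def convergent_def limI)
qed

end
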